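(* Let $(X_i)_{i\in\mathbb Z}$ be a strictly stationary sequence of real-valued random variables with common marginal law $\mu$. Let $(I_k)_{k>0}$ be a sequence of intervals of $\mathbb R$ such that $\mu(I_1)>0$ and $\sum_{k>0}\mu(I_k)=\infty$. Set $B_k=\{X_k\in I_k\}$ for $k>0$ and $E_n=\sum_{k=1}^n\mu(I_k)$. (i) If $\mu(\limsup_nI_n)>0$ and $\sum_{k>0}\tilde\beta_{1,1}(k)<\infty$, then $(B_k)_{k>0}$ is a Borel-Cantelli sequence. (ii) Let $p\in[1,\infty)$ and let $q$ be the conjugate exponent of $p$. If $$\lim_{n\to\infty}\frac1{E_n^p}\sum_{k=1}^{n-1}k^{p-1}\tilde\beta_{1,1}(k)=0\quad\text{and}\quad\sup_{n>0}\frac1{E_n}\Bigl\|\sum_{k=1}^n\mathbf 1_{I_k}(X_0)\Bigr\|_q<\infty,$$ then $(B_k)_{k>0}$ is an $L^1$ Borel-Cantelli sequence. (iii) Let $p\in[1,\infty)$ and let $q$ be the conjugate exponent of $p$. If $$\sum_{n>0}\frac{\mu(I_n)}{E_n^2}\Bigl(\sum_{k=1}^{n-1}k^{p-1}\tilde\beta_{1,1}(k)\Bigr)^{1/p}<\infty\quad\text{and}\quad\sup_{n>0}\frac1{E_n}\Bigl\|\sum_{k=1}^n\mathbf 1_{I_k}(X_0)\Bigr\|_q<\infty,$$ then $(B_k)_{k>0}$ is a strongly Borel-Cantelli sequence. (iv) If $\lim_{n\to\infty}E_n^{-1}\sum_{k=1}^{n-1}\tilde\varphi_{1,1}(k)=0$,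 then $(B_k)_{k>0}$ is an $L^1$ Borel-Cantelli sequence. (v) If $\sum_{n>0}E_n^{-1}\tilde\varphi_{1,1}(n)<\infty$, then $(B_k)_{k>0}$ is a strongly Borel-Cantelli sequence.
   Context: All random variables are defined on a probability space $(\Omega,\mathcal T,\mathbb P)$; $\|\cdot\|_q$ is the $L^q(\mathbb P)$ norm. For events $(B_k)_{k>0}$, write $S_n=\sum_{k=1}^n\mathbf 1_{B_k}$ and $E_n=\mathbb E(S_n)$. $(B_k)_{k>0}$ is a Borel-Cantelli sequence if $\mathbb P(\limsup_kB_k)=1$; it is an $L^1$ Borel-Cantelli sequence if $\sum_k\mathbb P(B_k)=\infty$ and $\lim_n\|S_n/E_n-1\|_1=0$; it is a strongly Borel-Cantelli sequence if $\sum_k\mathbb P(B_k)=\infty$ and $\lim_nS_n/E_n=1$ a.s. For a $\sigma$-field $\mathcal A\subset \mathcal T$ and a real random variable $X$, $$\tilde\beta(\mathcal A,X)=\Bigl\|\sup_{t\in\mathbb R}\bigl|\mathbb E(\mathbf 1_{X\le t}\mid\mathcal A)-\mathbb P(X\le t)\bigr|\Bigr\|_1,\qquad\tilde\varphi(\mathcal A,X)=\sup_{t\in\mathbb R}\bigl\|\mathbb E(\mathbf 1_{X\le t}\mid\mathcal A)-\mathbb P(X\le t)\bigr\|_\infty$$ (where $t\mapsto\mathbb E(\mathbf 1_{X\le t}\mid\mathcal A)$ is computed from a regular conditional distribution). For $n>0$, $\tilde\beta_{1,1}(n)=\tilde\beta(\sigma(X_0),X_n)$ and $\tilde\varphi_{1,1}(n)=\tilde\varphi(\sigma(X_0),X_n)$.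 *)

theory Defs
  imports "HOL-Probability.Probability"
begin

(* The L^q(M) norm for 1 <= q <= \<infinity>, with values in [0, \<infinity>]. *)
definition Lq_norm :: "'a measure \<Rightarrow> ennreal \<Rightarrow> ('a \<Rightarrow> real) \<Rightarrow> ennreal" where
  "Lq_norm M q f =
    (if q = \<infinity> then esssup M (\<lambda>\<omega>. ennreal \<bar>f \<omega>\<bar>)
     else let J = (\<integral>\<^sup>+ \<omega>. ennreal (\<bar>f \<omega>\<bar> powr enn2real q) \<partial>M)
          in if J = \<infinity> then \<infinity> else ennreal (enn2real J powr (1 / enn2real q)))"

definition partial_count :: "(nat \<Rightarrow> 'a set) \<Rightarrow> nat \<Rightarrow> 'a \<Rightarrow> real" where
  "partial_count B n \<omega> = (\<Sum>k=1..n. indicator (B k) \<omega>)"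

definition expected_count :: "'a measure \<Rightarrow> (nat \<Rightarrow> 'a set) \<Rightarrow> nat \<Rightarrow> real" where
  "expected_count M B n = (\<integral>\<omega>. partial_count B n \<omega> \<partial>M)"

(* Event sequences are indexed by k > 0.  They are modelled as functions on nat whose value
   at 0 is irrelevant; infinite series over k > 0 are therefore written with the index Suc k.
   On sets, limsup is the set-theoretic limes superior (mem_limsup_iff). *)

definition borel_cantelli_seq :: "'a measure \<Rightarrow> (nat \<Rightarrow> 'a set) \<Rightarrow> bool" where
  "borel_cantelli_seq M B \<longleftrightarrow> measure M (limsup B) = 1"

definition L1_borel_cantelli_seq :: "'a measure \<Rightarrow> (nat \<Rightarrow> 'a set) \<Rightarrow> bool" where
  "L1_borel_cantelli_seq M B \<longleftrightarrow>
     (\<Sum>k. emeasure M (B (Suc k))) = \<infinity> \<and>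
     (\<lambda>n. Lq_norm M 1 (\<lambda>\<omega>. partial_count B n \<omega> / expected_count M B n - 1)) \<longlonglongrightarrow> 0"

definition strongly_borel_cantelli_seq :: "'a measure \<Rightarrow> (nat \<Rightarrow> 'a set) \<Rightarrow> bool" where
  "strongly_borel_cantelli_seq M B \<longleftrightarrow>
     (\<Sum>k. emeasure M (B (Suc k))) = \<infinity> \<and>
     (AE \<omega> in M. (\<lambda>n. partial_count B n \<omega> / expected_count M B n) \<longlonglongrightarrow> 1)"

(* K is a regular conditional distribution of X given the sub-sigma-field F. *)
definition is_regular_cond_distr ::
    "'a measure \<Rightarrow> 'a measure \<Rightarrow> ('a \<Rightarrow> real) \<Rightarrow> ('a \<Rightarrow> real measure) \<Rightarrow> bool" where
  "is_regular_cond_distr M F X K \<longleftrightarrow>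
     K \<in> F \<rightarrow>\<^sub>M prob_algebra borel \<and>
     (\<forall>A\<in>sets borel. AE \<omega> in M.
        measure (K \<omega>) A = real_cond_exp M F (indicator (X -` A \<inter> space M)) \<omega>)"

(* A regular conditional distribution of a real random variable exists and is unique up to
   null sets, so the coefficients below do not depend on the version chosen here. *)
definition regular_cond_distr ::
    "'a measure \<Rightarrow> 'a measure \<Rightarrow> ('a \<Rightarrow> real) \<Rightarrow> 'a \<Rightarrow> real measure" where
  "regular_cond_distr M F X = (SOME K. is_regular_cond_distr M F X K)"

(* E(1_{X <= t} | F) - P(X <= t), computed from a regular conditional distribution *)
definition cond_cdf_diff ::
    "'a measure \<Rightarrow> 'a measure \<Rightarrow> ('a \<Rightarrow> real) \<Rightarrow> real \<Rightarrow> 'a \<Rightarrow> real" where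
  "cond_cdf_diff M F X t \<omega> =
     measure (regular_cond_distr M F X \<omega>) {..t} - measure M {\<omega> \<in> space M. X \<omega> \<le> t}"

(* Both coefficients lie in [0, 1], hence enn2real loses nothing. *)

definition beta_tilde :: "'a measure \<Rightarrow> 'a measure \<Rightarrow> ('a \<Rightarrow> real) \<Rightarrow> real" where
  "beta_tilde M F X = enn2real (Lq_norm M 1 (\<lambda>\<omega>. SUP t. \<bar>cond_cdf_diff M F X t \<omega>\<bar>))"

definition phi_tilde :: "'a measure \<Rightarrow> 'a measure \<Rightarrow> ('a \<Rightarrow> real) \<Rightarrow> real" where
  "phi_tilde M F X = enn2real (SUP t. Lq_norm M \<infinity> (cond_cdf_diff M F X t))"

definition sigma_gen :: "'a measure \<Rightarrow> ('a \<Rightarrow> real) \<Rightarrow> 'a measure" where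
  "sigma_gen M Y = vimage_algebra (space M) Y borel"

definition beta_tilde_11 :: "'a measure \<Rightarrow> (int \<Rightarrow> 'a \<Rightarrow> real) \<Rightarrow> nat \<Rightarrow> real" where
  "beta_tilde_11 M X n = beta_tilde M (sigma_gen M (X 0)) (X (int n))"

definition phi_tilde_11 :: "'a measure \<Rightarrow> (int \<Rightarrow> 'a \<Rightarrow> real) \<Rightarrow> nat \<Rightarrow> real" where
  "phi_tilde_11 M X n = phi_tilde M (sigma_gen M (X 0)) (X (int n))"

definition strictly_stationary :: "'a measure \<Rightarrow> (int \<Rightarrow> 'a \<Rightarrow> real) \<Rightarrow> bool" where
  "strictly_stationary M X \<longleftrightarrow>
     (\<forall>i. X i \<in> borel_measurable M) \<and>
     (\<forall>h. distr M (\<Pi>\<^sub>M i\<in>UNIV. borel) (\<lambda>\<omega> i. X (i + h) \<omega>) =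
          distr M (\<Pi>\<^sub>M i\<in>UNIV. borel) (\<lambda>\<omega> i. X i \<omega>))"

end

(* The pair (X_j, X_k) has the law of (X_0, X_{k-j}), and an interval is a difference of two
   half-lines, so the covariance of the events B_j and B_k is at most
   2 E(1_{I_j}(X_0) b_{k-j}), where b_d is the supremum over t of
   |P(X_d <= t | X_0) - P(X_d <= t)|.  Summation over pairs gives
     Var(S_n) <= E_n + 4 E((sum_{j<=n} 1_{I_j}(X_0)) (sum_{d<n} b_d)).
   The last expectation is bounded by E_n times the sum of the phi_d for (iv) and (v), and by
   Hoelder's inequality together with
     (sum_{d<n} b_d)^p <= p sum_{d<n} d^(p-1) b_d     (valid because 0 <= b_d <= 1)
   for (ii) and (iii).

   For strong convergence no subsequence is extracted: the variance bound makes
   sum_n mu(I_n)/E_n (S_n/E_n - 1)^2 finite almost surely, and since S_n and E_n are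
   nondecreasing and the weights are the relative increments of E_n, this forces S_n/E_n to
   tend to 1.

   For (i), a finite family of intervals has a subfamily with the same union in which no point
   is covered more than twice.  Applied to N successive blocks of indices beyond m, this gives a
   finite set of indices whose expected number of hits is at least N mu(limsup I_n)/2 while the
   variance is O(N).  By Chebyshev's inequality the probability of no hit after m is O(1/N). *)

theory Submission
  imports Defs
begin

text \<open>The coefficients rest on a kernel picked by \<open>SOME\<close>, so nothing can be said
  about them before a regular conditional distribution is known to exist.

  The obstacle with the supremum over t is that a conditional distribution function is fixed only up
  to null sets that may depend on t. Right continuity reduces everything to rational t. This makes
  b_d measurable, and it turns phi, where the supremum stands outside the essential supremum, into
  an almost sure bound on b_d. Hence one random variable serves all five claims.

  The 4 in the variance bound is 2 times 2: two half-lines for each interval and two orders for each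
  pair of indices.

  In (i) nothing limits how many of the I_k contain a given point, so the variance of S_n may be too
  large compared with E_n^2. Thinning out the intervals replaces the missing integrability by a
  pointwise bound on the number of hits; since only the occurrence of a hit matters, dropping events
  does no harm.\<close>

section \<open>Regular conditional distributions\<close>

text \<open>Bounded monotone sequences converge, so the conditional expectations have an almost sure
  limit. Integrating over the sets of \<open>F\<close> with dominated convergence identifies it. The
  functions meant here are indicators of half-lines.\<close>

lemma (in prob_space) real_cond_exp_monotone_limit:
  fixes f :: "nat \<Rightarrow> 'a \<Rightarrow> real" and g :: "'a \<Rightarrow> real"
  assumes sub: "subalgebra M F"
    and meas [measurable]: "\<And>n. f n \<in> borel_measurable M" "g \<in> borel_measurable M"
    and bounds: "\<And>n x. 0 \<le> f n x" "\<And>n x. f n x \<le> 1"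
    and lim: "\<And>x. (\<lambda>n. f n x) \<longlonglongrightarrow> g x"
    and mono: "(\<forall>n x. f n x \<le> f (Suc n) x) \<or> (\<forall>n x. f (Suc n) x \<le> f n x)"
  shows "AE x in M. (\<lambda>n. real_cond_exp M F (f n) x) \<longlonglongrightarrow> real_cond_exp M F g x"
proof -
  interpret finite_measure_subalgebra M F by standard (rule sub)
  let ?h = "\<lambda>n. real_cond_exp M F (f n)"
  let ?L = "\<lambda>x. lim (\<lambda>n. ?h n x)"
  have g01: "0 \<le> g x" "g x \<le> 1" for x
    using lim[of x] bounds by (auto intro: LIMSEQ_le_const LIMSEQ_le_const2)
  have int [simp, intro]: "integrable M (f n)" "integrable M g" for n
    using bounds g01 by (auto intro!: integrable_const_bound[where B = 1])
  have ae01: "AE x in M. \<forall>n. 0 \<le> ?h n x \<and> ?h n x \<le> 1"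
    unfolding AE_all_countable
    by (intro allI AE_conjI real_cond_exp_ge_c real_cond_exp_le_c) (use bounds in auto)
  have aemono: "AE x in M. monoseq (\<lambda>n. ?h n x)"
    using mono
  proof
    assume "\<forall>n x. f n x \<le> f (Suc n) x"
    then have "AE x in M. \<forall>n. ?h n x \<le> ?h (Suc n) x"
      unfolding AE_all_countable by (intro allI real_cond_exp_mono) auto
    then show ?thesis by (auto simp: monoseq_Suc)
  next
    assume "\<forall>n x. f (Suc n) x \<le> f n x"
    then have "AE x in M. \<forall>n. ?h (Suc n) x \<le> ?h n x"
      unfolding AE_all_countable by (intro allI real_cond_exp_mono) auto
    then show ?thesis by (auto simp: monoseq_Suc)
  qed
  have aelim: "AE x in M. (\<lambda>n. ?h n x) \<longlonglongrightarrow> ?L x"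
    using ae01 aemono
  proof eventually_elim
    case (elim x)
    then have "Bseq (\<lambda>n. ?h n x)" by (auto intro!: BseqI'[where K = 1])
    then show ?case
      using Bseq_monoseq_convergent elim by (auto simp: convergent_LIMSEQ_iff)
  qed
  have LF [measurable]: "?L \<in> borel_measurable F"
    by (rule borel_measurable_lim_metric) simp
  have LM [measurable]: "?L \<in> borel_measurable M"
    by (rule measurable_from_subalg[OF subalg LF])
  have "AE x in M. norm (?L x) \<le> 1"
    using ae01 aelim
  proof eventually_elim
    case (elim x)
    then have "0 \<le> ?L x" "?L x \<le> 1" by (auto intro: LIMSEQ_le_const LIMSEQ_le_const2)
    then show ?case by simp
  qed
  then have intL: "integrable M ?L"
    by (intro integrable_const_bound[where B = 1]) auto
  have "AE x in M. real_cond_exp M F g x = ?L x"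
  proof (rule real_cond_exp_charact)
    fix A assume A: "A \<in> sets F"
    then have [measurable]: "A \<in> sets M" using subalg by (auto simp: subalgebra_def)
    have "(\<lambda>n. \<integral>x\<in>A. f n x \<partial>M) \<longlonglongrightarrow> (\<integral>x\<in>A. g x \<partial>M)"
      unfolding set_lebesgue_integral_def
      by (rule integral_dominated_convergence[where w = "\<lambda>_. 1"])
        (use lim bounds in \<open>auto simp: indicator_def intro!: tendsto_eq_intros\<close>)
    moreover have "(\<lambda>n. \<integral>x\<in>A. ?h n x \<partial>M) \<longlonglongrightarrow> (\<integral>x\<in>A. ?L x \<partial>M)"
      unfolding set_lebesgue_integral_def
    proof (rule integral_dominated_convergence[where w = "\<lambda>_. 1"])
      show "AE x in M. (\<lambda>n. indicator A x *\<^sub>R ?h n x) \<longlonglongrightarrow> indicator A x *\<^sub>R ?L x"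
        using aelim by eventually_elim (auto intro!: tendsto_intros)
      show "AE x in M. norm (indicator A x *\<^sub>R ?h n x) \<le> 1" for n
        using ae01 by eventually_elim (auto simp: indicator_def)
    qed auto
    moreover have "(\<integral>x\<in>A. f n x \<partial>M) = (\<integral>x\<in>A. ?h n x \<partial>M)" for n
      by (rule real_cond_exp_intA) (use A in auto)
    ultimately show "(\<integral>x\<in>A. g x \<partial>M) = (\<integral>x\<in>A. ?L x \<partial>M)"
      by (auto intro: LIMSEQ_unique)
  qed (use intL in auto)
  with aelim show ?thesis by eventually_elim simp
qed

text \<open>An infimum over strictly larger rationals is right-continuous even where
  \<open>g\<close> jumps, so \<open>g\<close> only has to be monotone on the rationals with the
  right limits; \<open>h\<close> may differ from \<open>g\<close> at rational points.\<close>

lemma right_limit_of_rational_cdf: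
  fixes g :: "real \<Rightarrow> real"
  assumes mono: "\<And>q r. q \<in> \<rat> \<Longrightarrow> r \<in> \<rat> \<Longrightarrow> q \<le> r \<Longrightarrow> g q \<le> g r"
    and bounds: "\<And>q. q \<in> \<rat> \<Longrightarrow> 0 \<le> g q \<and> g q \<le> 1"
    and top: "(\<lambda>n. g (real n)) \<longlonglongrightarrow> 1" and bot: "(\<lambda>n. g (- real n)) \<longlonglongrightarrow> 0"
  defines "h \<equiv> \<lambda>x. INF q\<in>{q \<in> \<rat>. x < q}. g q"
  shows "x \<le> y \<Longrightarrow> h x \<le> h y" "continuous (at_right x) h" "(h \<longlongrightarrow> 0) at_bot" "(h \<longlongrightarrow> 1) at_top"
proof -
  have ne: "{q \<in> \<rat>. x < q} \<noteq> {}" for x :: real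
    using Rats_dense_in_real[of x "x + 1"] by auto
  have bd: "bdd_below (g ` {q \<in> \<rat>. x < q})" for x
    using bounds by (auto intro!: bdd_belowI2[where m = 0])
  have hle: "h x \<le> g q" if "q \<in> \<rat>" "x < q" for x q
    unfolding h_def using that by (intro cINF_lower[OF bd]) auto
  have leh: "c \<le> h x" if "\<And>q. q \<in> \<rat> \<Longrightarrow> x < q \<Longrightarrow> c \<le> g q" for x c
    unfolding h_def using that by (intro cINF_greatest[OF ne]) auto
  show mono_h: "h x \<le> h y" if "x \<le> y" for x y
    by (rule leh) (use that in \<open>auto intro: hle\<close>)
  have h01: "0 \<le> h x" "h x \<le> 1" for x
  proof -
    show "0 \<le> h x" by (rule leh) (use bounds in auto)
    obtain q where "q \<in> \<rat>" "x < q" using ne[of x] by auto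
    then show "h x \<le> 1" using hle[of q x] bounds[of q] by linarith
  qed
  have "(h \<longlongrightarrow> h x) (at_right x)" for x
  proof (rule order_tendstoI)
    fix a assume "a < h x"
    then show "\<forall>\<^sub>F y in at_right x. a < h y"
      unfolding eventually_at_right_field
      by (intro exI[of _ "x + 1"]) (auto intro: less_le_trans[OF _ mono_h[OF less_imp_le]])
  next
    fix a assume "h x < a"
    then obtain q where q: "q \<in> \<rat>" "x < q" "g q < a"
      using leh[of x a] by (metis not_le)
    then show "\<forall>\<^sub>F y in at_right x. h y < a"
      unfolding eventually_at_right_field
      by (intro exI[of _ q]) (auto intro: le_less_trans hle)
  qed
  then show "continuous (at_right x) h" by (simp add: continuous_within)
  show "(h \<longlongrightarrow> 0) at_bot"
  proof (rule order_tendstoI)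
    fix a :: real assume "a < 0"
    then show "\<forall>\<^sub>F x in at_bot. a < h x" by (auto intro!: always_eventually less_le_trans[OF _ h01(1)])
  next
    fix a :: real assume "0 < a"
    then obtain n where "g (- real n) < a"
      using order_tendstoD(2)[OF bot, of a] by (auto simp: eventually_sequentially)
    then have "h x < a" if "x < - real n" for x
      using hle[of "- real n" x] that by auto
    then show "\<forall>\<^sub>F x in at_bot. h x < a"
      unfolding eventually_at_bot_dense by blast
  qed
  show "(h \<longlongrightarrow> 1) at_top"
  proof (rule order_tendstoI)
    fix a :: real assume "1 < a"
    then show "\<forall>\<^sub>F x in at_top. h x < a" by (auto intro!: always_eventually le_less_trans[OF h01(2)])
  next
    fix a :: real assume "a < 1"
    then obtain n where n: "a < g (real n)"
      using order_tendstoD(1)[OF top, of a] by (auto simp: eventually_sequentially)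
    have "a < h x" if "x > real n" for x
    proof -
      have "g (real n) \<le> h x" by (rule leh) (use that in \<open>auto intro: mono\<close>)
      with n show ?thesis by simp
    qed
    then show "\<forall>\<^sub>F x in at_top. a < h x"
      unfolding eventually_at_top_dense by blast
  qed
qed

lemma borel_sigma_sets_atMost: "sets (borel :: real measure) = sigma_sets UNIV (range atMost)"
  by (subst borel_eq_atMost) simp

lemma Int_stable_atMost: "Int_stable (range (atMost :: real \<Rightarrow> real set))"
  by (auto simp: Int_stable_def)

lemma range_atMost_Pow: "range (atMost :: real \<Rightarrow> real set) \<subseteq> Pow UNIV"
  by simp

text \<open>The half-lines form an intersection-stable generator of the Borel sets, so agreement on
  them spreads to all Borel sets by a Dynkin class argument.\<close>

lemma (in prob_space) regular_cond_distr_from_cdf: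
  fixes X :: "'a \<Rightarrow> real" and K :: "'a \<Rightarrow> real measure"
  assumes sub: "subalgebra M F" and X [measurable]: "X \<in> borel_measurable M"
    and K: "K \<in> F \<rightarrow>\<^sub>M prob_algebra borel"
    and cdf: "\<And>t. AE \<omega> in M. measure (K \<omega>) {..t} = real_cond_exp M F (indicator (X -` {..t} \<inter> space M)) \<omega>"
  shows "is_regular_cond_distr M F X K"
proof -
  interpret finite_measure_subalgebra M F by standard (rule sub)
  have spF: "space F = space M" using sub by (simp add: subalgebra_def)
  have KM: "K \<in> M \<rightarrow>\<^sub>M prob_algebra borel"
    by (rule measurable_from_subalg[OF sub K])
  have Kp: "prob_space (K \<omega>)" "sets (K \<omega>) = sets borel" if "\<omega> \<in> space M" for \<omega>
    using measurable_space[OF KM that] by (auto simp: space_prob_algebra)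
  have KeF [measurable]: "(\<lambda>\<omega>. emeasure (K \<omega>) A) \<in> borel_measurable F" if "A \<in> sets borel" for A
    by (rule measurable_emeasure_kernel[OF measurable_prob_algebraD[OF K] that])
  have KeM [measurable]: "(\<lambda>\<omega>. emeasure (K \<omega>) A) \<in> borel_measurable M" if "A \<in> sets borel" for A
    by (rule measurable_from_subalg[OF sub KeF[OF that]])
  have KmF [measurable]: "(\<lambda>\<omega>. measure (K \<omega>) A) \<in> borel_measurable F" if "A \<in> sets borel" for A
    unfolding measure_def using that by measurable
  have KmM [measurable]: "(\<lambda>\<omega>. measure (K \<omega>) A) \<in> borel_measurable M" if "A \<in> sets borel" for A
    by (rule measurable_from_subalg[OF sub KmF[OF that]])
  have Ke: "emeasure (K \<omega>) A = ennreal (measure (K \<omega>) A)" if "\<omega> \<in> space M" for \<omega> A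
    using Kp(1)[OF that] by (simp add: finite_measure.emeasure_eq_measure prob_space_def)
  have Km1: "measure (K \<omega>) A \<le> 1" if "\<omega> \<in> space M" for \<omega> A
    using Kp(1)[OF that] by (simp add: prob_space.prob_le_1)
  have Kint [simp]: "integrable M (\<lambda>\<omega>. measure (K \<omega>) A)" if "A \<in> sets borel" for A
    using that Km1 by (intro integrable_const_bound[where B = 1]) auto
  \<comment> \<open>For fixed \<open>C\<close> both sides are finite measures in \<open>A\<close>.
    Comparing integrals instead of conditional expectations keeps exceptional null sets out of the
    induction, and in \<open>ennreal\<close> countable unions pass through the integral without
    integrability conditions.\<close>
  have key: "(\<integral>\<^sup>+\<omega>\<in>C. emeasure (K \<omega>) A \<partial>M) = emeasure M (C \<inter> X -` A)"
    if C: "C \<in> sets F" and A: "A \<in> sets borel" for A C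
  proof -
    have CM [measurable]: "C \<in> sets M" using C sub by (auto simp: subalgebra_def)
    then have CX: "C \<inter> X -` A = C \<inter> (X -` A \<inter> space M)" for A
      using sets.sets_into_space by blast
    have "A \<in> sigma_sets UNIV (range atMost)" using A by (simp add: borel_sigma_sets_atMost)
    from Int_stable_atMost range_atMost_Pow this show ?thesis
    proof (induction rule: sigma_sets_induct_disjoint)
      case (basic A)
      then obtain t where t: "A = {..t}" by auto
      let ?G = "real_cond_exp M F (indicator (X -` A \<inter> space M))"
      have "(\<integral>\<omega>\<in>C. measure (K \<omega>) A \<partial>M) = (\<integral>\<omega>\<in>C. ?G \<omega> \<partial>M)"
        unfolding set_lebesgue_integral_def t
        by (rule integral_cong_AE) (use cdf[of t] in auto)
      also have "\<dots> = (\<integral>\<omega>\<in>C. indicator (X -` A \<inter> space M) \<omega> \<partial>M)"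
        by (rule real_cond_exp_intA[symmetric])
          (use C t in \<open>auto intro!: integrable_const_bound[where B = 1]\<close>)
      also have "\<dots> = (\<integral>\<omega>. indicator (C \<inter> X -` A) \<omega> \<partial>M)"
        unfolding set_lebesgue_integral_def
        by (rule Bochner_Integration.integral_cong) (auto simp: indicator_def)
      also have "\<dots> = measure M (C \<inter> X -` A)"
        using t by (simp add: CX)
      finally have eq: "(\<integral>\<omega>\<in>C. measure (K \<omega>) A \<partial>M) = measure M (C \<inter> X -` A)" .
      have "(\<integral>\<^sup>+\<omega>\<in>C. emeasure (K \<omega>) A \<partial>M) = (\<integral>\<^sup>+\<omega>. ennreal (indicator C \<omega> * measure (K \<omega>) A) \<partial>M)"
        by (rule nn_integral_cong) (auto simp: Ke indicator_def)
      also have "\<dots> = ennreal (\<integral>\<omega>. indicator C \<omega> * measure (K \<omega>) A \<partial>M)"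
        by (rule nn_integral_eq_integral)
          (use t integrable_real_mult_indicator[OF CM, of "\<lambda>\<omega>. measure (K \<omega>) A"] in \<open>auto simp: mult.commute\<close>)
      finally show ?case using eq by (simp add: set_lebesgue_integral_def emeasure_eq_measure)
    next
      case empty
      then show ?case by simp
    next
      case (compl A)
      then have [measurable]: "A \<in> sets borel" by (simp add: borel_sigma_sets_atMost)
      have "(\<integral>\<^sup>+\<omega>\<in>C. emeasure (K \<omega>) (UNIV - A) \<partial>M)
          = (\<integral>\<^sup>+\<omega>. indicator C \<omega> - emeasure (K \<omega>) A * indicator C \<omega> \<partial>M)"
      proof (rule nn_integral_cong)
        fix \<omega> assume w: "\<omega> \<in> space M"
        have "emeasure (K \<omega>) (UNIV - A) = 1 - emeasure (K \<omega>) A"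
          using prob_space.emeasure_space_1[OF Kp(1)[OF w]] sets_eq_imp_space_eq[OF Kp(2)[OF w]]
            emeasure_compl[of A "K \<omega>"] Kp(2)[OF w] Ke[OF w] by simp
        then show "emeasure (K \<omega>) (UNIV - A) * indicator C \<omega> = indicator C \<omega> - emeasure (K \<omega>) A * indicator C \<omega>"
          by (simp add: indicator_def)
      qed
      also have "\<dots> = (\<integral>\<^sup>+\<omega>. indicator C \<omega> \<partial>M) - (\<integral>\<^sup>+\<omega>\<in>C. emeasure (K \<omega>) A \<partial>M)"
      proof (rule nn_integral_diff)
        show "(\<integral>\<^sup>+\<omega>\<in>C. emeasure (K \<omega>) A \<partial>M) \<noteq> \<infinity>"
          using compl by simp
        show "AE \<omega> in M. emeasure (K \<omega>) A * indicator C \<omega> \<le> indicator C \<omega>"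
          using Km1 by (auto simp: Ke indicator_def)
      qed auto
      also have "\<dots> = emeasure M C - emeasure M (C \<inter> X -` A)"
        using compl by simp
      also have "\<dots> = emeasure M (C - C \<inter> X -` A)"
        by (rule emeasure_Diff[symmetric]) (auto simp: CX)
      also have "C - C \<inter> X -` A = C \<inter> X -` (UNIV - A)" by auto
      finally show ?case .
    next
      case (union A)
      then have [measurable]: "A i \<in> sets borel" for i by (auto simp: borel_sigma_sets_atMost)
      have "(\<integral>\<^sup>+\<omega>\<in>C. emeasure (K \<omega>) (\<Union>i. A i) \<partial>M)
          = (\<integral>\<^sup>+\<omega>. (\<Sum>i. emeasure (K \<omega>) (A i) * indicator C \<omega>) \<partial>M)"
      proof (rule nn_integral_cong)
        fix \<omega> assume w: "\<omega> \<in> space M"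
        have "emeasure (K \<omega>) (\<Union>i. A i) = (\<Sum>i. emeasure (K \<omega>) (A i))"
          using union(1) by (intro suminf_emeasure[symmetric]) (auto simp: Kp(2)[OF w])
        then show "emeasure (K \<omega>) (\<Union>i. A i) * indicator C \<omega> = (\<Sum>i. emeasure (K \<omega>) (A i) * indicator C \<omega>)"
          by (simp add: ennreal_suminf_multc)
      qed
      also have "\<dots> = (\<Sum>i. \<integral>\<^sup>+\<omega>\<in>C. emeasure (K \<omega>) (A i) \<partial>M)"
        by (rule nn_integral_suminf) auto
      also have "\<dots> = (\<Sum>i. emeasure M (C \<inter> X -` A i))"
        using union(3) by simp
      also have "\<dots> = emeasure M (\<Union>i. C \<inter> X -` A i)"
        using union(1) by (intro suminf_emeasure) (auto simp: CX disjoint_family_on_def)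
      also have "(\<Union>i. C \<inter> X -` A i) = C \<inter> X -` (\<Union>i. A i)" by auto
      finally show ?case .
    qed
  qed
  have "AE \<omega> in M. measure (K \<omega>) A = real_cond_exp M F (indicator (X -` A \<inter> space M)) \<omega>"
    if A [measurable]: "A \<in> sets borel" for A
  proof -
    have "AE \<omega> in M. real_cond_exp M F (indicator (X -` A \<inter> space M)) \<omega> = measure (K \<omega>) A"
    proof (rule real_cond_exp_charact)
      fix C assume C: "C \<in> sets F"
      then have CM [measurable]: "C \<in> sets M" using sub by (auto simp: subalgebra_def)
      have CX: "C \<inter> X -` A = C \<inter> (X -` A \<inter> space M)"
        using CM sets.sets_into_space by blast
      have "ennreal (\<integral>\<omega>\<in>C. measure (K \<omega>) A \<partial>M) = (\<integral>\<^sup>+\<omega>. ennreal (indicator C \<omega> * measure (K \<omega>) A) \<partial>M)"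
        unfolding set_lebesgue_integral_def real_scaleR_def
        by (rule nn_integral_eq_integral[symmetric])
          (use integrable_real_mult_indicator[OF CM, of "\<lambda>\<omega>. measure (K \<omega>) A"] in \<open>auto simp: mult.commute\<close>)
      also have "\<dots> = (\<integral>\<^sup>+\<omega>\<in>C. emeasure (K \<omega>) A \<partial>M)"
        by (rule nn_integral_cong) (auto simp: Ke indicator_def)
      also have "\<dots> = ennreal (measure M (C \<inter> X -` A))"
        using key[OF C A] by (simp add: emeasure_eq_measure)
      finally have "(\<integral>\<omega>\<in>C. measure (K \<omega>) A \<partial>M) = measure M (C \<inter> X -` A)"
        by (subst (asm) ennreal_inj) (auto simp: set_lebesgue_integral_def intro!: Bochner_Integration.integral_nonneg)
      moreover have "(\<integral>\<omega>\<in>C. indicator (X -` A \<inter> space M) \<omega> \<partial>M) = (\<integral>\<omega>. (indicator (C \<inter> X -` A) \<omega> :: real) \<partial>M)"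
        unfolding set_lebesgue_integral_def
        by (rule Bochner_Integration.integral_cong) (auto simp: indicator_def)
      ultimately show "(\<integral>\<omega>\<in>C. indicator (X -` A \<inter> space M) \<omega> \<partial>M) = (\<integral>\<omega>\<in>C. measure (K \<omega>) A \<partial>M)"
        by (simp add: CX)
    qed (auto intro!: integrable_const_bound[where B = 1])
    then show ?thesis by eventually_elim simp
  qed
  with K show ?thesis by (simp add: is_regular_cond_distr_def)
qed


lemma (in prob_space) regular_cond_distr_exists:
  fixes X :: "'a \<Rightarrow> real"
  assumes sub: "subalgebra M F" and X [measurable]: "X \<in> borel_measurable M"
  shows "\<exists>K. is_regular_cond_distr M F X K"
proof -
  interpret finite_measure_subalgebra M F by standard (rule sub)
  let ?f = "\<lambda>t. indicator (X -` {..t} \<inter> space M) :: 'a \<Rightarrow> real"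
  define G where "G t = real_cond_exp M F (?f t)" for t
  have [measurable]: "G t \<in> borel_measurable F" "G t \<in> borel_measurable M" for t
    unfolding G_def by auto
  have fint [simp]: "integrable M (?f t)" for t
    by (rule integrable_const_bound[where B = 1]) auto
  \<comment> \<open>These are countably many conditions, each almost surely true, and they are what
    a distribution function needs of its rational values; by monotonicity the limits may be taken
    along integers.\<close>
  define good where "good \<omega> \<longleftrightarrow>
      (\<forall>q\<in>\<rat>. \<forall>r\<in>\<rat>. q \<le> r \<longrightarrow> G q \<omega> \<le> G r \<omega>) \<and> (\<forall>q\<in>\<rat>. 0 \<le> G q \<omega> \<and> G q \<omega> \<le> 1) \<and>
      (\<lambda>n. G (real n) \<omega>) \<longlonglongrightarrow> 1 \<and> (\<lambda>n. G (- real n) \<omega>) \<longlonglongrightarrow> 0" for \<omega>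
  have good_meas [measurable]: "Measurable.pred F good"
    unfolding good_def using countable_rat by measurable
  have ae_mono: "AE \<omega> in M. G q \<omega> \<le> G r \<omega>" if "q \<le> r" for q r
    unfolding G_def using that
    by (intro real_cond_exp_mono) (auto simp: indicator_def)
  have ae_bd: "AE \<omega> in M. 0 \<le> G q \<omega> \<and> G q \<omega> \<le> 1" for q
    unfolding G_def by (intro AE_conjI real_cond_exp_ge_c real_cond_exp_le_c) (auto simp: indicator_def)
  have top: "AE \<omega> in M. (\<lambda>n. G (real n) \<omega>) \<longlonglongrightarrow> 1"
  proof -
    have "AE \<omega> in M. (\<lambda>n. G (real n) \<omega>) \<longlonglongrightarrow> real_cond_exp M F (indicator (space M)) \<omega>"
      unfolding G_def
    proof (rule real_cond_exp_monotone_limit[OF sub])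
      show "(\<lambda>n. ?f (real n) x) \<longlonglongrightarrow> indicator (space M) x" for x
      proof (rule tendsto_eventually)
        obtain N :: nat where N: "X x \<le> real N" using real_arch_simple by blast
        show "\<forall>\<^sub>F n in sequentially. ?f (real n) x = indicator (space M) x"
          using eventually_ge_at_top[of N] by eventually_elim (use N in \<open>auto simp: indicator_def\<close>)
      qed
    qed (auto simp: indicator_def)
    moreover have "AE \<omega> in M. real_cond_exp M F (indicator (space M)) \<omega> = indicator (space M) \<omega>"
    proof (rule real_cond_exp_F_meas)
      have "space M \<in> sets F" using sub sets.top[of F] by (simp add: subalgebra_def)
      then show "indicator (space M) \<in> borel_measurable F" by (rule borel_measurable_indicator)
      show "integrable M (indicator (space M) :: 'a \<Rightarrow> real)"
        by (rule integrable_const_bound[where B = 1]) auto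
    qed
    moreover note AE_space
    ultimately show ?thesis by eventually_elim simp
  qed
  have bot: "AE \<omega> in M. (\<lambda>n. G (- real n) \<omega>) \<longlonglongrightarrow> 0"
  proof -
    have "AE \<omega> in M. (\<lambda>n. G (- real n) \<omega>) \<longlonglongrightarrow> real_cond_exp M F (\<lambda>_. 0) \<omega>"
      unfolding G_def
    proof (rule real_cond_exp_monotone_limit[OF sub])
      show "(\<lambda>n. ?f (- real n) x) \<longlonglongrightarrow> 0" for x
      proof (rule tendsto_eventually)
        obtain N :: nat where N: "- X x < real N" using reals_Archimedean2 by blast
        show "\<forall>\<^sub>F n in sequentially. ?f (- real n) x = 0"
          using eventually_ge_at_top[of N] by eventually_elim (use N in \<open>auto simp: indicator_def\<close>)
      qed
    qed (auto simp: indicator_def)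
    moreover have "AE \<omega> in M. real_cond_exp M F (\<lambda>_. 0) \<omega> = 0"
      by (rule real_cond_exp_F_meas) auto
    ultimately show ?thesis by eventually_elim simp
  qed
  have "AE \<omega> in M. \<forall>q\<in>\<rat>. \<forall>r\<in>\<rat>. q \<le> r \<longrightarrow> G q \<omega> \<le> G r \<omega>"
    using ae_mono by (auto intro!: AE_ball_countable' countable_rat)
  moreover have "AE \<omega> in M. \<forall>q\<in>\<rat>. 0 \<le> G q \<omega> \<and> G q \<omega> \<le> 1"
    using ae_bd by (intro AE_ball_countable' countable_rat) auto
  ultimately have ae_good: "AE \<omega> in M. good \<omega>"
    using top bot unfolding good_def by eventually_elim blast
  \<comment> \<open>off the good set, the distribution function of the unit mass at 0\<close>
  define g where "g \<omega> q = (if good \<omega> then G q \<omega> else if q \<ge> 0 then 1 else 0)" for \<omega> and q :: real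
  have g_mono: "g \<omega> q \<le> g \<omega> r" if "q \<in> \<rat>" "r \<in> \<rat>" "q \<le> r" for \<omega> q r
    using that unfolding g_def good_def by auto
  have g_bd: "0 \<le> g \<omega> q \<and> g \<omega> q \<le> 1" if "q \<in> \<rat>" for \<omega> q
    using that unfolding g_def good_def by auto
  have g_top: "(\<lambda>n. g \<omega> (real n)) \<longlonglongrightarrow> 1" for \<omega>
    by (cases "good \<omega>") (simp add: g_def, simp add: good_def, simp add: g_def)
  have g_bot: "(\<lambda>n. g \<omega> (- real n)) \<longlonglongrightarrow> 0" for \<omega>
  proof (cases "good \<omega>")
    case False
    have "\<forall>\<^sub>F n in sequentially. g \<omega> (- real n) = 0"
      using eventually_gt_at_top[of 0] by eventually_elim (simp add: g_def False)
    then show ?thesis by (rule tendsto_eventually)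
  qed (simp add: g_def, simp add: good_def)
  have [measurable]: "(\<lambda>\<omega>. g \<omega> q) \<in> borel_measurable F" for q
    unfolding g_def by measurable
  define h where "h \<omega> x = (INF q\<in>{q \<in> \<rat>. x < q}. g \<omega> q)" for \<omega> x
  note h = right_limit_of_rational_cdf[OF g_mono g_bd g_top g_bot, folded h_def]
  have rat_countable: "countable {q \<in> \<rat>. x < q}" for x :: real
    by (rule countable_subset[OF _ countable_rat]) auto
  have bdd_g: "bdd_below ((\<lambda>q. g \<omega> q) ` {q \<in> \<rat>. x < q})" for x \<omega>
    using g_bd by (auto intro!: bdd_belowI2[where m = 0])
  have h_meas [measurable]: "(\<lambda>\<omega>. h \<omega> x) \<in> borel_measurable F" for x
    unfolding h_def by (rule borel_measurable_cINF[OF rat_countable]) (auto intro!: bdd_g)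
  define K where "K \<omega> = interval_measure (h \<omega>)" for \<omega>
  have K_cdf: "emeasure (K \<omega>) {..t} = h \<omega> t" "measure (K \<omega>) {..t} = h \<omega> t" for \<omega> t
    unfolding K_def using emeasure_interval_measure_Iic measure_interval_measure_Iic h by auto
  have K_meas: "K \<in> F \<rightarrow>\<^sub>M prob_algebra borel"
  proof (rule measurable_prob_algebra_generated[OF borel_sigma_sets_atMost Int_stable_atMost range_atMost_Pow])
    fix \<omega>
    interpret K: real_distribution "K \<omega>"
      unfolding K_def by (intro real_distribution_interval_measure h)
    show "prob_space (K \<omega>)" "sets (K \<omega>) = sets borel"
      by (auto intro: K.prob_space_axioms)
  qed (auto simp: K_cdf)
  \<comment> \<open>At real \<open>t\<close> the kernel is computed from rationals to the right of
    \<open>t\<close>, whereas \<open>G t\<close> is fixed separately up to a null set. A sequence of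
    rationals decreasing to \<open>t\<close> links the two.\<close>
  have "AE \<omega> in M. measure (K \<omega>) {..t} = G t \<omega>" for t
  proof -
    have "\<exists>q\<in>\<rat>. t < q \<and> q < t + 1 / real (Suc n)" for n
      using Rats_dense_in_real[of t "t + 1 / real (Suc n)"] by auto
    then obtain r where r: "\<And>n. r n \<in> \<rat>" "\<And>n. t < r n" "\<And>n. r n < t + 1 / real (Suc n)"
      by metis
    \<comment> \<open>Running minima make the rational approximations decreasing, as the monotone
      limit lemma requires.\<close>
    define s where "s n = Min (r ` {..n})" for n
    have s_in: "s n \<in> r ` {..n}" for n unfolding s_def by (intro Min_in) auto
    have s: "s n \<in> \<rat>" "t < s n" for n using s_in[of n] r(1,2) by auto
    have s_le: "s n \<le> r n" for n unfolding s_def by simp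
    have s_lt: "s n < t + 1 / real (Suc n)" for n using s_le[of n] r(3)[of n] by linarith
    have s_dec: "s (Suc n) \<le> s n" for n
      unfolding s_def by (intro Min_antimono) auto
    have s_lim: "s \<longlonglongrightarrow> t"
    proof (rule tendsto_sandwich[where f = "\<lambda>_. t" and h = "\<lambda>n. t + 1 / real (Suc n)"])
      have "(\<lambda>n. t + inverse (real (Suc n))) \<longlonglongrightarrow> t + 0"
        by (intro tendsto_intros LIMSEQ_inverse_real_of_nat)
      then show "(\<lambda>n. t + 1 / real (Suc n)) \<longlonglongrightarrow> t" by (simp add: inverse_eq_divide)
    qed (use s s_lt in \<open>auto intro!: eventuallyI less_imp_le\<close>)
    have "AE \<omega> in M. (\<lambda>n. G (s n) \<omega>) \<longlonglongrightarrow> G t \<omega>"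
      unfolding G_def
    proof (rule real_cond_exp_monotone_limit[OF sub])
      show "(\<lambda>n. ?f (s n) x) \<longlonglongrightarrow> ?f t x" for x
      proof (rule tendsto_eventually, cases "X x \<le> t")
        case True
        then show "\<forall>\<^sub>F n in sequentially. ?f (s n) x = ?f t x"
          using s(2) by (intro eventuallyI) (auto simp: indicator_def intro: order_trans less_imp_le)
      next
        case False
        then have "\<forall>\<^sub>F n in sequentially. s n < X x"
          using order_tendstoD(2)[OF s_lim] by simp
        then show "\<forall>\<^sub>F n in sequentially. ?f (s n) x = ?f t x"
          by eventually_elim (use False in \<open>auto simp: indicator_def\<close>)
      qed
      show "(\<forall>n x. ?f (s n) x \<le> ?f (s (Suc n)) x) \<or> (\<forall>n x. ?f (s (Suc n)) x \<le> ?f (s n) x)"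
        using s_dec by (auto simp: indicator_def intro: order_trans)
    qed (auto simp: indicator_def)
    \<comment> \<open>\<open>good\<close> compares rational arguments only, and \<open>t\<close> may
      be irrational.\<close>
    moreover have "AE \<omega> in M. \<forall>q\<in>\<rat>. t < q \<longrightarrow> G t \<omega> \<le> G q \<omega>"
      using ae_mono by (intro AE_ball_countable' countable_rat) auto
    ultimately have "AE \<omega> in M. h \<omega> t = G t \<omega>"
      using ae_good
    proof eventually_elim
      case (elim \<omega>)
      have gG: "g \<omega> q = G q \<omega>" for q using elim by (simp add: g_def)
      have "G t \<omega> \<le> h \<omega> t"
        unfolding h_def using elim Rats_dense_in_real[of t "t + 1"]
        by (intro cINF_greatest) (auto simp: gG)
      moreover have "h \<omega> t \<le> G (s n) \<omega>" for n
        unfolding h_def gG[symmetric] by (rule cINF_lower[OF bdd_g]) (use s in auto)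
      then have "h \<omega> t \<le> G t \<omega>" using elim by (intro LIMSEQ_le_const) auto
      ultimately show ?case by simp
    qed
    then show ?thesis by (simp add: K_cdf)
  qed
  then have "is_regular_cond_distr M F X K"
    unfolding G_def by (intro regular_cond_distr_from_cdf[OF sub X K_meas])
  then show ?thesis by blast
qed

text \<open>Existence is what gives the \<open>SOME\<close> in \<open>regular_cond_distr\<close> its
  defining properties.\<close>

lemma (in prob_space) regular_cond_distr_is_regular:
  fixes X :: "'a \<Rightarrow> real"
  assumes "subalgebra M F" "X \<in> borel_measurable M"
  shows "is_regular_cond_distr M F X (regular_cond_distr M F X)"
  unfolding regular_cond_distr_def by (rule someI_ex[OF regular_cond_distr_exists[OF assms]])

section \<open>Inequalities and a deterministic ratio criterion\<close>

text \<open>Adding \<open>x n\<close> to the partial sum T raises \<open>T powr p\<close> by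
  \<open>p * z powr (p - 1) * x n\<close> for some z below \<open>T + x n\<close>, and
  \<open>T + x n\<close> is at most n because every term is at most 1.\<close>

lemma power_sum_le:
  fixes x :: "nat \<Rightarrow> real"
  assumes p: "p \<ge> 1" and x: "\<And>k. 0 \<le> x k" "\<And>k. x k \<le> 1"
  shows "(\<Sum>k=1..<n. x k) powr p \<le> p * (\<Sum>k=1..<n. real k powr (p - 1) * x k)"
proof (induction n)
  case (Suc n)
  show ?case
  proof (cases "n = 0")
    case False
    let ?T = "\<Sum>k=1..<n. x k"
    have T0: "0 \<le> ?T" using x by (intro sum_nonneg)
    have "(\<Sum>k=1..<n. x k) \<le> (\<Sum>k=1..<n. 1)" using x by (intro sum_mono)
    then have Tn: "?T + x n \<le> real n" using x(2)[of n] False by (simp add: of_nat_diff)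
    have "(?T + x n) powr p - ?T powr p \<le> p * (real n powr (p - 1) * x n)"
    \<comment> \<open>The mean value theorem is applied on a nondegenerate interval with positive
      left end, where \<open>powr\<close> is differentiable; the degenerate cases are treated by
      hand.\<close>
    proof (cases "x n = 0 \<or> ?T = 0")
      case True
      show ?thesis
      proof (cases "x n = 0")
        case xn: False
        with True have T: "?T = 0" by simp
        have pos: "0 < x n" using xn x(1)[of n] by simp
        have "x n powr p = x n powr (p - 1) * x n"
          using pos by (simp add: powr_mult_base mult.commute)
        also have "\<dots> \<le> 1 * (real n powr (p - 1) * x n)"
          using Tn T pos p by (auto intro!: mult_right_mono powr_mono2)
        also have "\<dots> \<le> p * (real n powr (p - 1) * x n)"
          using p pos by (intro mult_right_mono) auto
        finally show ?thesis using T p by simp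
      qed simp
    next
      case False
      then have pos: "0 < x n" "0 < ?T" using x(1)[of n] T0 by auto
      have "\<exists>z>?T. z < ?T + x n \<and>
          (?T + x n) powr p - ?T powr p = (?T + x n - ?T) * (p * z powr (p - 1))"
        using pos by (intro MVT2) (auto intro!: has_real_derivative_powr)
      then obtain z where z: "z > ?T" "z < ?T + x n"
        "(?T + x n) powr p - ?T powr p = x n * (p * z powr (p - 1))" by auto
      have "x n * (p * z powr (p - 1)) \<le> x n * (p * real n powr (p - 1))"
        using z pos p Tn by (intro mult_left_mono powr_mono2) auto
      with z(3) show ?thesis by (simp add: mult_ac)
    qed
    then show ?thesis using Suc.IH False by (simp add: distrib_left)
  qed (use p in simp)
qed simp

text \<open>Young's inequality for \<open>f / a\<close> and \<open>g / b\<close>, integrated. Here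
  \<open>a\<close> and \<open>b\<close> are upper bounds for the norms rather than the norms
  themselves, which suits a first factor that is known only through an estimate.\<close>

lemma nn_integral_Holder:
  fixes f g :: "'a \<Rightarrow> real"
  assumes [measurable]: "f \<in> borel_measurable M" "g \<in> borel_measurable M"
    and nn: "\<And>x. 0 \<le> f x" "\<And>x. 0 \<le> g x"
    and pq: "p > 1" "q > 1" "1 / p + 1 / q = (1::real)"
    and f: "(\<integral>\<^sup>+x. ennreal (f x powr q) \<partial>M) \<le> ennreal (a powr q)"
    and g: "(\<integral>\<^sup>+x. ennreal (g x powr p) \<partial>M) \<le> ennreal (b powr p)"
    and ab: "a > 0" "b \<ge> 0"
  shows "(\<integral>\<^sup>+x. ennreal (f x * g x) \<partial>M) \<le> ennreal (a * b)"
\<comment> \<open>In the application \<open>b\<close> is zero when all the coefficients summed are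
  zero, for instance in an empty sum. Then \<open>g\<close> vanishes almost everywhere.\<close>
proof (cases "b = 0")
  case True
  then have "(\<integral>\<^sup>+x. ennreal (g x powr p) \<partial>M) = 0" using g pq by simp
  then have "AE x in M. ennreal (g x powr p) = 0" by (subst (asm) nn_integral_0_iff_AE) auto
  then have "AE x in M. ennreal (f x * g x) = 0"
    by eventually_elim (use nn pq in \<open>auto simp: ennreal_eq_0_iff\<close>)
  then show ?thesis by (subst nn_integral_cong_AE) auto
next
  case False
  then have ab: "a > 0" "b > 0" using ab by auto
  have "(\<integral>\<^sup>+x. ennreal (f x * g x) \<partial>M)
      \<le> (\<integral>\<^sup>+x. ennreal (a * b / q / a powr q) * ennreal (f x powr q)
          + ennreal (a * b / p / b powr p) * ennreal (g x powr p) \<partial>M)"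
  proof (rule nn_integral_mono)
    fix x
    have "(f x / a) * (g x / b) \<le> (f x / a) powr q / q + (g x / b) powr p / p"
      using nn ab pq by (intro Youngs_inequality) auto
    then have "a * b * ((f x / a) * (g x / b)) \<le> a * b * ((f x / a) powr q / q + (g x / b) powr p / p)"
      using ab by (intro mult_left_mono) auto
    also have "\<dots> = a * b / q / a powr q * (f x powr q) + a * b / p / b powr p * (g x powr p)"
      using ab nn by (simp add: powr_divide field_simps)
    finally have "f x * g x \<le> a * b / q / a powr q * (f x powr q) + a * b / p / b powr p * (g x powr p)"
      using ab by simp
    then show "ennreal (f x * g x) \<le> ennreal (a * b / q / a powr q) * ennreal (f x powr q)
          + ennreal (a * b / p / b powr p) * ennreal (g x powr p)"
      using ab pq by (simp add: ennreal_mult[symmetric] ennreal_plus[symmetric] ennreal_leI del: ennreal_plus)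
  qed
  also have "\<dots> = ennreal (a * b / q / a powr q) * (\<integral>\<^sup>+x. ennreal (f x powr q) \<partial>M)
      + ennreal (a * b / p / b powr p) * (\<integral>\<^sup>+x. ennreal (g x powr p) \<partial>M)"
    by (simp add: nn_integral_add nn_integral_cmult)
  also have "\<dots> \<le> ennreal (a * b / q / a powr q) * ennreal (a powr q)
      + ennreal (a * b / p / b powr p) * ennreal (b powr p)"
    using f g by (intro add_mono mult_left_mono) auto
  also have "\<dots> = ennreal (a * b / q + a * b / p)"
    using ab pq by (simp add: ennreal_mult[symmetric] ennreal_plus[symmetric] del: ennreal_plus)
  also have "a * b / q + a * b / p = a * b * (1 / p + 1 / q)" by (simp add: field_simps)
  finally show ?thesis using pq by simp
qed

text \<open>If S/E exceeded 1 by a fixed amount at some index, then by monotonicity it would stay away from 1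
  until E has grown by a fixed factor, which costs a fixed amount of the weighted sum; in the same
  way, a deficit would have been present since E was smaller by a fixed factor.\<close>

lemma increasing_ratio_tendsto_1:
  fixes S E :: "nat \<Rightarrow> real"
  assumes S: "incseq S" and S0: "\<And>n. 0 \<le> S n"
    and E: "incseq E" and E0: "\<And>n. n > 0 \<Longrightarrow> 0 < E n" "0 \<le> E 0"
    and step: "\<And>n. E (Suc n) \<le> E n + 1"
    and lim: "filterlim E at_top sequentially"
    and sum: "summable (\<lambda>n. (E (Suc n) - E n) / E (Suc n) * (S (Suc n) / E (Suc n) - 1)\<^sup>2)"
  shows "(\<lambda>n. S n / E n) \<longlonglongrightarrow> 1"
proof -
  let ?f = "\<lambda>n. (E (Suc n) - E n) / E (Suc n) * (S (Suc n) / E (Suc n) - 1)\<^sup>2"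
  have Emono: "E m \<le> E n" if "m \<le> n" for m n using E that by (simp add: incseq_def)
  have Smono: "S m \<le> S n" if "m \<le> n" for m n using S that by (simp add: incseq_def)
  have ratio0: "0 \<le> (E (Suc n) - E n) / E (Suc n)" for n
    using Emono[of n "Suc n"] E0(1)[of "Suc n"] by simp
  \<comment> \<open>Replacing each \<open>E (Suc i)\<close> in the denominator by the larger
    \<open>E m\<close> makes the weights telescope. The term with index i looks at
    \<open>Suc i\<close>, hence the half-open range of far indices.\<close>
  have block: "(\<Sum>i=l..<m. ?f i) \<ge> \<delta>\<^sup>2 * ((E m - E l) / E m)"
    if far: "\<And>i. l < i \<Longrightarrow> i \<le> m \<Longrightarrow> \<delta> \<le> \<bar>S i / E i - 1\<bar>" and "0 < \<delta>" "l < m" for l m \<delta>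
  proof -
    have "\<delta>\<^sup>2 * ((E m - E l) / E m) = (\<Sum>i=l..<m. \<delta>\<^sup>2 * ((E (Suc i) - E i) / E m))"
      using that by (simp add: sum_distrib_left[symmetric] sum_divide_distrib[symmetric] sum_Suc_diff')
    also have "\<dots> \<le> (\<Sum>i=l..<m. ?f i)"
    proof (rule sum_mono)
      fix i assume i: "i \<in> {l..<m}"
      have "\<delta>\<^sup>2 \<le> (S (Suc i) / E (Suc i) - 1)\<^sup>2"
        using far[of "Suc i"] i \<open>0 < \<delta>\<close> by (simp add: abs_le_square_iff[symmetric])
      moreover have "(E (Suc i) - E i) / E m \<le> (E (Suc i) - E i) / E (Suc i)"
        using i Emono[of "Suc i" m] Emono[of i "Suc i"] E0(1)[of "Suc i"]
        by (intro divide_left_mono) auto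
      ultimately have "\<delta>\<^sup>2 * ((E (Suc i) - E i) / E m)
          \<le> (S (Suc i) / E (Suc i) - 1)\<^sup>2 * ((E (Suc i) - E i) / E (Suc i))"
        using ratio0 Emono[of i "Suc i"] E0(1)[of m] i by (intro mult_mono) auto
      then show "\<delta>\<^sup>2 * ((E (Suc i) - E i) / E m) \<le> ?f i" by (simp add: mult.commute)
    qed
    finally show ?thesis .
  qed
  \<comment> \<open>By the Cauchy criterion, blocks that cost at least
    \<open>\<delta>\<^sup>2 * \<eta>\<close> cannot occur arbitrarily far out. \<open>N k\<close>
    bounds from below the start of the block found at \<open>k\<close>; a block may lie to the left
    of \<open>k\<close>.\<close>
  have no_far_block: False
    if d: "0 < \<delta>" "0 < \<eta>" and far: "\<exists>\<^sub>F k in sequentially. \<exists>l m. N k \<le> l \<and> l < m \<and>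
          \<eta> \<le> (E m - E l) / E m \<and> (\<forall>i. l < i \<longrightarrow> i \<le> m \<longrightarrow> \<delta> \<le> \<bar>S i / E i - 1\<bar>)"
      and N: "filterlim N at_top sequentially" for \<delta> \<eta> and N :: "nat \<Rightarrow> nat"
  proof -
    have "0 < \<delta>\<^sup>2 * \<eta>" using d by simp
    then obtain n0 where n0: "\<And>l m. n0 \<le> l \<Longrightarrow> norm (\<Sum>i=l..<m. ?f i) < \<delta>\<^sup>2 * \<eta>"
      using sum unfolding summable_Cauchy by blast
    have "\<forall>\<^sub>F k in sequentially. n0 \<le> N k" using N by (simp add: filterlim_at_top)
    from frequently_ex[OF frequently_eventually_frequently[OF far this]]
    obtain k l m where "n0 \<le> N k" "N k \<le> l" "l < m" "\<eta> \<le> (E m - E l) / E m"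
        "\<forall>i. l < i \<longrightarrow> i \<le> m \<longrightarrow> \<delta> \<le> \<bar>S i / E i - 1\<bar>"
      by blast
    then have "\<delta>\<^sup>2 * \<eta> \<le> (\<Sum>i=l..<m. ?f i)" "norm (\<Sum>i=l..<m. ?f i) < \<delta>\<^sup>2 * \<eta>"
      using block[of l m \<delta>] d n0[of l m] by (auto intro: order_trans[OF mult_left_mono])
    then show False by simp
  qed
  have upper: "\<forall>\<^sub>F k in sequentially. S k / E k < 1 + \<epsilon>" if \<epsilon>: "0 < \<epsilon>" "\<epsilon> < 1" for \<epsilon>
  proof (rule ccontr)
    assume "\<not> ?thesis"
    then have fr: "\<exists>\<^sub>F k in sequentially. 1 + \<epsilon> \<le> S k / E k"
      by (simp add: not_eventually not_less)
    \<comment> \<open>A step of \<open>E\<close> is at most 1, which is then below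
      \<open>\<epsilon> / 8 * E k\<close>. So the last index before \<open>E\<close> passes
      \<open>(1 + \<epsilon> / 2) * E k\<close> still has \<open>E\<close> above
      \<open>(1 + \<epsilon> / 4) * E k\<close>.\<close>
    have "\<forall>\<^sub>F k in sequentially. 8 / \<epsilon> < E k"
      using lim by (simp add: filterlim_at_top_dense)
    from frequently_eventually_frequently[OF fr this] have "\<exists>\<^sub>F k in sequentially. \<exists>l m. k \<le> l \<and> l < m \<and> \<epsilon> / 16 \<le> (E m - E l) / E m \<and>
        (\<forall>i. l < i \<longrightarrow> i \<le> m \<longrightarrow> \<epsilon> / 4 \<le> \<bar>S i / E i - 1\<bar>)"
    proof (rule frequently_elim1)
      fix k assume k: "1 + \<epsilon> \<le> S k / E k \<and> 8 / \<epsilon> < E k"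
      have "0 < 8 / \<epsilon>" using \<epsilon> by simp
      then have "0 < E k" using k by linarith
      moreover have "8 < \<epsilon> * E k" using k \<epsilon> by (simp add: divide_less_eq mult.commute)
      ultimately have Ek: "8 < \<epsilon> * E k" "0 < E k" by auto
      have SkEk: "(1 + \<epsilon>) * E k \<le> S k" using k Ek by (simp add: le_divide_eq)
      obtain n where "(1 + \<epsilon> / 2) * E k < E n"
        using lim unfolding filterlim_at_top_dense eventually_sequentially by blast
      then have "\<exists>n. (1 + \<epsilon> / 2) * E k < E n" by blast
      \<comment> \<open>The block starts at \<open>k\<close> and ends just before \<open>n1\<close>.
        On it \<open>S\<close> is at least \<open>(1 + \<epsilon>) * E k\<close> and
        \<open>E\<close> at most \<open>(1 + \<epsilon> / 2) * E k\<close>; as \<open>(1 +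
        \<epsilon> / 4) * (1 + \<epsilon> / 2) \<le> 1 + \<epsilon>\<close>, an excess of
        \<open>\<epsilon> / 4\<close> remains.\<close>
      define n1 where "n1 = (LEAST n. (1 + \<epsilon> / 2) * E k < E n)"
      have n1: "(1 + \<epsilon> / 2) * E k < E n1" unfolding n1_def by (rule LeastI_ex) fact
      have least: "E i \<le> (1 + \<epsilon> / 2) * E k" if "i < n1" for i
        using not_less_Least[of i] that unfolding n1_def by force
      have "k < n1"
      proof (rule ccontr)
        assume "\<not> k < n1"
        then have "E n1 \<le> E k" using Emono by simp
        moreover have "0 < \<epsilon> * E k" using Ek by linarith
        ultimately show False using n1 by (simp add: distrib_right)
      qed
      then obtain m where m: "n1 = Suc m" "k \<le> m" by (cases n1) auto
      have Em: "E m \<le> (1 + \<epsilon> / 2) * E k" using least[of m] m by simp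
      have Em2: "(1 + \<epsilon> / 4) * E k < E m"
      proof -
        have "(1 + \<epsilon> / 2) * E k < E m + 1" using n1 step[of m] m by simp
        then show ?thesis using Ek by (simp add: distrib_right)
      qed
      have "k \<noteq> m"
      proof
        assume "k = m"
        then show False using Em2 Ek by (simp add: distrib_right)
      qed
      have Empos: "0 < E m" using Emono[OF m(2)] Ek by simp
      have "\<epsilon> / 16 * E m \<le> \<epsilon> / 16 * ((1 + \<epsilon> / 2) * E k)"
        using Em \<epsilon> by (intro mult_left_mono) auto
      also have "\<dots> \<le> \<epsilon> / 16 * (2 * E k)"
        using \<epsilon> Ek by (intro mult_left_mono mult_right_mono) auto
      also have "\<dots> \<le> \<epsilon> / 4 * E k" using \<epsilon> Ek by simp
      also have "\<dots> \<le> E m - E k" using Em2 by (simp add: distrib_right)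
      finally have "\<epsilon> / 16 \<le> (E m - E k) / E m" using Empos by (simp add: le_divide_eq)
      moreover have "\<epsilon> / 4 \<le> \<bar>S i / E i - 1\<bar>" if i: "k < i" "i \<le> m" for i
      proof -
        have Ei: "0 < E i" "E i \<le> (1 + \<epsilon> / 2) * E k"
          using i Emono[of k i] Emono[of i m] Em Ek by auto
        have "(1 + \<epsilon> / 4) * E i \<le> (1 + \<epsilon> / 4) * ((1 + \<epsilon> / 2) * E k)"
          using Ei \<epsilon> by (intro mult_left_mono) auto
        also have "\<dots> = ((1 + \<epsilon> / 4) * (1 + \<epsilon> / 2)) * E k" by simp
        also have "\<dots> \<le> (1 + \<epsilon>) * E k"
        proof (rule mult_right_mono)
          have "\<epsilon> * \<epsilon> \<le> \<epsilon> * 1" using \<epsilon> by (intro mult_left_mono) auto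
          moreover have "(1 + \<epsilon> / 4) * (1 + \<epsilon> / 2) = 1 + \<epsilon> * 3 / 4 + \<epsilon> * \<epsilon> / 8"
            by (simp add: field_simps)
          ultimately show "(1 + \<epsilon> / 4) * (1 + \<epsilon> / 2) \<le> 1 + \<epsilon>" using \<epsilon> by linarith
        qed (use Ek in simp)
        also have "\<dots> \<le> S i" using SkEk Smono[of k i] i by simp
        finally have "1 + \<epsilon> / 4 \<le> S i / E i" using Ei by (simp add: le_divide_eq)
        then show ?thesis by linarith
      qed
      ultimately show "\<exists>l m. k \<le> l \<and> l < m \<and> \<epsilon> / 16 \<le> (E m - E l) / E m \<and>
          (\<forall>i. l < i \<longrightarrow> i \<le> m \<longrightarrow> \<epsilon> / 4 \<le> \<bar>S i / E i - 1\<bar>)"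
        using m \<open>k \<noteq> m\<close> by (intro exI[of _ k] exI[of _ m]) auto
    qed
    then show False by (rule no_far_block[rotated 2]) (use \<epsilon> in \<open>auto intro: filterlim_ident\<close>)
  qed
  have lower: "\<forall>\<^sub>F k in sequentially. 1 - \<epsilon> < S k / E k" if \<epsilon>: "0 < \<epsilon>" "\<epsilon> < 1" for \<epsilon>
  proof (rule ccontr)
    assume "\<not> ?thesis"
    then have fr: "\<exists>\<^sub>F k in sequentially. S k / E k \<le> 1 - \<epsilon>"
      by (simp add: not_eventually not_less)
    \<comment> \<open>Here the block ends at \<open>k\<close>. The shift by \<open>Suc\<close> makes
      \<open>N k\<close> its excluded left end: all later i have
      \<open>E i \<ge> (1 - \<epsilon> / 2) * E k\<close>, while
      \<open>S i \<le> S k \<le> (1 - \<epsilon>) * E k\<close>. Since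
      \<open>1 - \<epsilon> \<le> (1 - \<epsilon> / 2)\<^sup>2\<close>, a deficit of
      \<open>\<epsilon> / 2\<close> remains.\<close>
    define N where "N k = (LEAST n. (1 - \<epsilon> / 2) * E k \<le> E (Suc n))" for k
    have Nprop: "(1 - \<epsilon> / 2) * E k \<le> E (Suc (N k))" for k
      unfolding N_def
    proof (rule LeastI)
      have "0 \<le> E k" using E0 by (cases k) (auto intro: less_imp_le)
      then have "0 \<le> \<epsilon> / 2 * E k" using \<epsilon> by simp
      then have "(1 - \<epsilon> / 2) * E k \<le> E k" by (simp add: left_diff_distrib)
      then show "(1 - \<epsilon> / 2) * E k \<le> E (Suc k)" using Emono[of k "Suc k"] by linarith
    qed
    have Nleast: "E (Suc i) < (1 - \<epsilon> / 2) * E k" if "i < N k" for i k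
      using not_less_Least[of i] that unfolding N_def by force
    have Nlim: "filterlim N at_top sequentially"
      unfolding filterlim_at_top
    proof
      fix Z
      have "\<forall>\<^sub>F k in sequentially. E (Suc Z) / (1 - \<epsilon> / 2) < E k"
        using lim by (simp add: filterlim_at_top_dense)
      then show "\<forall>\<^sub>F k in sequentially. Z \<le> N k"
      proof eventually_elim
        case (elim k)
        show ?case
        proof (rule ccontr)
          assume "\<not> Z \<le> N k"
          then have "E (Suc (N k)) \<le> E (Suc Z)" by (intro Emono) simp
          moreover have "E (Suc Z) < (1 - \<epsilon> / 2) * E k"
            using elim \<epsilon> by (simp add: divide_less_eq mult.commute)
          ultimately show False using Nprop[of k] by simp
        qed
      qed
    qed
    \<comment> \<open>If \<open>N k\<close> is positive, minimality can be used at its predecessor,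
      which bounds \<open>E (N k)\<close> itself.\<close>
    have "\<forall>\<^sub>F k in sequentially. 1 \<le> N k"
      using Nlim by (simp only: filterlim_at_top)
    then have "\<forall>\<^sub>F k in sequentially. 8 / \<epsilon> < E k \<and> 0 < N k"
      using lim by (intro eventually_conj) (simp_all add: filterlim_at_top_dense Suc_le_eq)
    from frequently_eventually_frequently[OF fr this] have "\<exists>\<^sub>F k in sequentially. \<exists>l m. N k \<le> l \<and> l < m \<and> \<epsilon> / 4 \<le> (E m - E l) / E m \<and>
        (\<forall>i. l < i \<longrightarrow> i \<le> m \<longrightarrow> \<epsilon> / 2 \<le> \<bar>S i / E i - 1\<bar>)"
    proof (rule frequently_elim1)
      fix k assume k: "S k / E k \<le> 1 - \<epsilon> \<and> 8 / \<epsilon> < E k \<and> 0 < N k"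
      have "0 < 8 / \<epsilon>" using \<epsilon> by simp
      then have "0 < E k" using k by linarith
      moreover have "8 < \<epsilon> * E k" using k \<epsilon> by (simp add: divide_less_eq mult.commute)
      ultimately have Ek: "8 < \<epsilon> * E k" "0 < E k" by auto
      have SkEk: "S k \<le> (1 - \<epsilon>) * E k" using k Ek by (simp add: divide_le_eq)
      obtain l where l: "N k = Suc l" using k by (cases "N k") auto
      have "E (N k) < (1 - \<epsilon> / 2) * E k" using Nleast[of l k] l by simp
      then have EN: "\<epsilon> / 4 * E k \<le> E k - E (N k)" using Ek by (simp add: algebra_simps)
      have "0 < \<epsilon> / 4 * E k" using Ek by simp
      then have "E (N k) < E k" using EN by linarith
      then have "N k < k" using Emono[of k "N k"] by (meson not_le)
      moreover have "\<epsilon> / 4 \<le> (E k - E (N k)) / E k" using EN Ek by (simp add: le_divide_eq)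
      moreover have "\<epsilon> / 2 \<le> \<bar>S i / E i - 1\<bar>" if i: "N k < i" "i \<le> k" for i
      proof -
        have Ei: "0 < E i" "(1 - \<epsilon> / 2) * E k \<le> E i"
          using E0(1)[of i] i Nprop[of k] Emono[of "Suc (N k)" i] by auto
        have "S i \<le> (1 - \<epsilon>) * E k" using SkEk Smono[of i k] i by simp
        also have "\<dots> \<le> ((1 - \<epsilon> / 2) * (1 - \<epsilon> / 2)) * E k"
          using Ek by (intro mult_right_mono) (auto simp: algebra_simps)
        also have "\<dots> = (1 - \<epsilon> / 2) * ((1 - \<epsilon> / 2) * E k)" by simp
        also have "\<dots> \<le> (1 - \<epsilon> / 2) * E i"
          using Ei \<epsilon> by (intro mult_left_mono) auto
        finally have "S i / E i \<le> 1 - \<epsilon> / 2" using Ei by (simp add: divide_le_eq)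
        then show ?thesis by linarith
      qed
      ultimately show "\<exists>l m. N k \<le> l \<and> l < m \<and> \<epsilon> / 4 \<le> (E m - E l) / E m \<and>
          (\<forall>i. l < i \<longrightarrow> i \<le> m \<longrightarrow> \<epsilon> / 2 \<le> \<bar>S i / E i - 1\<bar>)"
        by (intro exI[of _ "N k"] exI[of _ k]) auto
    qed
    then show False by (rule no_far_block[rotated 2]) (use \<epsilon> Nlim in auto)
  qed
  show ?thesis
  proof (rule order_tendstoI)
    fix a :: real assume a: "a < 1"
    show "\<forall>\<^sub>F k in sequentially. a < S k / E k"
      by (rule eventually_mono[OF lower[of "min (1 - a) (1/2)"]]) (use a in auto)
  next
    fix a :: real assume a: "1 < a"
    show "\<forall>\<^sub>F k in sequentially. S k / E k < a"
      by (rule eventually_mono[OF upper[of "min (a - 1) (1/2)"]]) (use a in auto)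
  qed
qed

section \<open>Conditional probabilities of intervals\<close>

text \<open>The b_d of the overview for a general pair. Its mean is \<open>beta_tilde\<close>, and
  almost surely it is at most \<open>phi_tilde\<close>.\<close>

definition cdf_gap :: "'a measure \<Rightarrow> 'a measure \<Rightarrow> ('a \<Rightarrow> real) \<Rightarrow> 'a \<Rightarrow> real" where
  "cdf_gap M F X \<omega> = (SUP t. \<bar>cond_cdf_diff M F X t \<omega>\<bar>)"

text \<open>Cutting an interval out of down-closed sets, and not out of half-lines given by end
  points, treats open, closed, unbounded and empty intervals alike.\<close>

lemma interval_discrepancy_le:
  assumes "real_distribution P" "real_distribution Q"
    and gap: "\<And>t. \<bar>measure P {..t} - measure Q {..t}\<bar> \<le> s" and J: "is_interval J"
  shows "\<bar>measure P J - measure Q J\<bar> \<le> 2 * s"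
proof -
  interpret P: real_distribution P by fact
  interpret Q: real_distribution Q by fact
  have s0: "0 \<le> s" using gap[of 0] by linarith
  have down: "\<bar>measure P L - measure Q L\<bar> \<le> s" if L: "\<And>x y. y \<in> L \<Longrightarrow> x \<le> y \<Longrightarrow> x \<in> L" for L
  proof -
    have "L = {} \<or> L = UNIV \<or> (\<exists>t. L = {..t}) \<or> (\<exists>t. L = {..<t})"
    proof (cases "L = {} \<or> \<not> bdd_above L")
      case True
      then show ?thesis
        using L by (auto simp: bdd_above_def) (meson UNIV_eq_I linear)
    next
      case False
      then have "L \<noteq> {}" "bdd_above L" by auto
      show ?thesis
      proof (cases "Sup L \<in> L")
        case True
        have "L = {..Sup L}" using L True cSup_upper[OF _ \<open>bdd_above L\<close>] by auto
        then show ?thesis by blast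
      next
        case False
        have "L = {..<Sup L}"
        proof (intro set_eqI iffI)
          fix x assume "x \<in> L"
          then show "x \<in> {..<Sup L}"
            using False cSup_upper[OF \<open>x \<in> L\<close> \<open>bdd_above L\<close>] by (cases "x = Sup L") auto
        next
          fix x assume "x \<in> {..<Sup L}"
          then obtain y where "y \<in> L" "x < y"
            using less_cSupE[OF _ \<open>L \<noteq> {}\<close>] by auto
          then show "x \<in> L" using L by auto
        qed
        then show ?thesis by blast
      qed
    qed
    then consider "L = {}" | "L = UNIV" | t where "L = {..t}" | t where "L = {..<t}" by blast
    then show ?thesis
    proof cases
      case 2
      then show ?thesis using s0 P.prob_space Q.prob_space by simp
    next
      \<comment> \<open>An open half-line is reached from closed ones through the left limits of the
        distribution functions.\<close>
      case 4
      have "((\<lambda>x. cdf P x - cdf Q x) \<longlongrightarrow> measure P {..<t} - measure Q {..<t}) (at_left t)"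
        by (intro tendsto_intros P.cdf_at_left Q.cdf_at_left)
      from tendsto_rabs[OF this] have "((\<lambda>x. \<bar>cdf P x - cdf Q x\<bar>) \<longlongrightarrow> \<bar>measure P {..<t} - measure Q {..<t}\<bar>) (at_left t)" .
      then have "\<bar>measure P {..<t} - measure Q {..<t}\<bar> \<le> s"
        by (rule tendsto_upperbound) (use gap in \<open>auto simp: cdf_def\<close>)
      with 4 show ?thesis by simp
    qed (use s0 gap in auto)
  qed
  \<comment> \<open>J is a difference of two down-closed sets, and each of them contributes at most s\<close>
  define L1 where "L1 = {x. \<exists>y\<in>J. x \<le> y}"
  define L2 where "L2 = L1 - J"
  have L2_down: "x \<in> L2" if "y \<in> L2" "x \<le> y" for x y
  proof -
    obtain z where z: "z \<in> J" "y \<le> z" "y \<notin> J" using \<open>y \<in> L2\<close> by (auto simp: L1_def L2_def)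
    have "x \<notin> J" using J z \<open>x \<le> y\<close> unfolding is_interval_1 by blast
    moreover have "x \<le> z" using z \<open>x \<le> y\<close> by linarith
    ultimately show ?thesis using z(1) unfolding L1_def L2_def by blast
  qed
  have L1_down: "x \<in> L1" if "y \<in> L1" "x \<le> y" for x y
    using that unfolding L1_def by (auto intro: order_trans)
  have "is_interval L1" "is_interval L2"
    using L1_down L2_down unfolding is_interval_1 by blast+
  then have [simp]: "L1 \<in> sets borel" "L2 \<in> sets borel" by (auto intro: real_interval_borel_measurable)
  have "J = L1 - L2" "L2 \<subseteq> L1" by (auto simp: L1_def L2_def)
  then have "measure P J = measure P L1 - measure P L2" "measure Q J = measure Q L1 - measure Q L2"
    using P.finite_measure_Diff[of L1 L2] Q.finite_measure_Diff[of L1 L2] by auto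
  moreover have "\<bar>measure P L1 - measure Q L1\<bar> \<le> s" using down L1_down by blast
  moreover have "\<bar>measure P L2 - measure Q L2\<bar> \<le> s" using down L2_down by blast
  ultimately show ?thesis by linarith
qed

text \<open>If the bound failed at t, it would fail on an interval to the right of t, which contains
  a rational.\<close>

lemma right_continuous_abs_le_of_rats:
  fixes f :: "real \<Rightarrow> real"
  assumes "continuous (at_right t) f" and le: "\<And>q. q \<in> \<rat> \<Longrightarrow> \<bar>f q\<bar> \<le> c"
  shows "\<bar>f t\<bar> \<le> c"
proof (rule ccontr)
  assume "\<not> ?thesis"
  moreover have "((\<lambda>x. \<bar>f x\<bar>) \<longlongrightarrow> \<bar>f t\<bar>) (at_right t)"
    using assms(1) by (intro tendsto_intros) (simp add: continuous_within)
  ultimately have "\<forall>\<^sub>F x in at_right t. c < \<bar>f x\<bar>" by (auto intro: order_tendstoD)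
  then obtain b where "t < b" "\<And>y. t < y \<Longrightarrow> y < b \<Longrightarrow> c < \<bar>f y\<bar>"
    unfolding eventually_at_right_field by blast
  moreover obtain q where "q \<in> \<rat>" "t < q" "q < b"
    using Rats_dense_in_real[OF \<open>t < b\<close>] by blast
  ultimately show False using le[of q] by fastforce
qed

context prob_space
begin

context
  fixes F :: "'a measure" and X :: "'a \<Rightarrow> real"
  assumes sub: "subalgebra M F" and X [measurable]: "X \<in> borel_measurable M"
begin

abbreviation (input) "cond_law \<equiv> regular_cond_distr M F X"

lemma regular_cond_distr_measurable: "cond_law \<in> F \<rightarrow>\<^sub>M prob_algebra borel"
  using regular_cond_distr_is_regular[OF sub X] by (simp add: is_regular_cond_distr_def)

lemma real_distribution_regular_cond_distr:
  assumes "\<omega> \<in> space M" shows "real_distribution (cond_law \<omega>)"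
proof -
  have "cond_law \<omega> \<in> space (prob_algebra borel)"
    using measurable_space[OF regular_cond_distr_measurable] assms sub by (simp add: subalgebra_def)
  then show ?thesis
    unfolding real_distribution_def real_distribution_axioms_def
    by (auto simp: space_prob_algebra sets_eq_imp_space_eq)
qed

lemma cond_cdf_diff_eq: "cond_cdf_diff M F X t \<omega> = cdf (cond_law \<omega>) t - cdf (distr M borel X) t"
  by (auto simp: cond_cdf_diff_def cdf_def measure_distr intro!: arg_cong[where f = "measure M"])

lemma regular_cond_distr_measure_measurable:
  assumes "A \<in> sets borel"
  shows "(\<lambda>\<omega>. measure (cond_law \<omega>) A) \<in> borel_measurable F"
proof -
  have [measurable]: "(\<lambda>\<omega>. emeasure (cond_law \<omega>) A) \<in> borel_measurable F"
    by (rule measurable_emeasure_kernel[OF measurable_prob_algebraD[OF regular_cond_distr_measurable] assms])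
  show ?thesis unfolding measure_def by measurable
qed

lemma cond_cdf_diff_measurable [measurable]: "cond_cdf_diff M F X t \<in> borel_measurable M"
  unfolding cond_cdf_diff_def
  using measurable_from_subalg[OF sub regular_cond_distr_measure_measurable[of "{..t}"]] by simp

lemma cond_cdf_diff_bounded: "\<omega> \<in> space M \<Longrightarrow> \<bar>cond_cdf_diff M F X t \<omega>\<bar> \<le> 1"
proof -
  assume "\<omega> \<in> space M"
  then interpret K: real_distribution "cond_law \<omega>" by (rule real_distribution_regular_cond_distr)
  interpret D: real_distribution "distr M borel X" by simp
  show ?thesis
    unfolding cond_cdf_diff_eq
    using K.cdf_nonneg[of t] K.cdf_bounded_prob[of t] D.cdf_nonneg[of t] D.cdf_bounded_prob[of t] by linarith
qed

lemma cond_cdf_diff_right_cont: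
  "\<omega> \<in> space M \<Longrightarrow> continuous (at_right t) (\<lambda>t. cond_cdf_diff M F X t \<omega>)"
proof -
  assume "\<omega> \<in> space M"
  then interpret K: real_distribution "cond_law \<omega>" by (rule real_distribution_regular_cond_distr)
  interpret D: real_distribution "distr M borel X" by simp
  show ?thesis
    unfolding cond_cdf_diff_eq by (intro continuous_diff K.cdf_is_right_cont D.cdf_is_right_cont)
qed

lemma cond_cdf_diff_le_gap: "\<omega> \<in> space M \<Longrightarrow> \<bar>cond_cdf_diff M F X t \<omega>\<bar> \<le> cdf_gap M F X \<omega>"
  unfolding cdf_gap_def by (rule cSUP_upper) (auto intro!: bdd_aboveI2 cond_cdf_diff_bounded)

lemma cdf_gap_nonneg: "\<omega> \<in> space M \<Longrightarrow> 0 \<le> cdf_gap M F X \<omega>"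
  using cond_cdf_diff_le_gap[of \<omega> 0] by linarith

lemma cdf_gap_le_1: "\<omega> \<in> space M \<Longrightarrow> cdf_gap M F X \<omega> \<le> 1"
  unfolding cdf_gap_def by (rule cSUP_least) (auto intro!: cond_cdf_diff_bounded)

lemma cdf_gap_le:
  assumes "\<omega> \<in> space M" "\<And>q. q \<in> \<rat> \<Longrightarrow> \<bar>cond_cdf_diff M F X q \<omega>\<bar> \<le> c"
  shows "cdf_gap M F X \<omega> \<le> c"
  unfolding cdf_gap_def
proof (rule cSUP_least)
  fix t :: real
  show "\<bar>cond_cdf_diff M F X t \<omega>\<bar> \<le> c"
    by (rule right_continuous_abs_le_of_rats[OF cond_cdf_diff_right_cont]) (use assms in auto)
qed simp

lemma cdf_gap_measurable [measurable]: "cdf_gap M F X \<in> borel_measurable M"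
proof -
  have bdd: "bdd_above ((\<lambda>q. \<bar>cond_cdf_diff M F X q \<omega>\<bar>) ` \<rat>)" if "\<omega> \<in> space M" for \<omega>
    using that by (auto intro!: bdd_aboveI2 cond_cdf_diff_bounded)
  have "cdf_gap M F X \<omega> = (SUP q\<in>\<rat>. \<bar>cond_cdf_diff M F X q \<omega>\<bar>)" if w: "\<omega> \<in> space M" for \<omega>
  proof (rule antisym)
    show "cdf_gap M F X \<omega> \<le> (SUP q\<in>\<rat>. \<bar>cond_cdf_diff M F X q \<omega>\<bar>)"
      by (rule cdf_gap_le[OF w]) (intro cSUP_upper bdd w)
    show "(SUP q\<in>\<rat>. \<bar>cond_cdf_diff M F X q \<omega>\<bar>) \<le> cdf_gap M F X \<omega>"
      by (rule cSUP_least) (use Rats_0 cond_cdf_diff_le_gap[OF w] in auto)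
  qed
  then show ?thesis
    by (subst measurable_cong) (auto intro!: borel_measurable_cSUP countable_rat bdd)
qed

lemma cdf_gap_integrable [simp]: "integrable M (cdf_gap M F X)"
  using cdf_gap_nonneg cdf_gap_le_1 by (intro integrable_const_bound[where B = 1]) auto

lemma beta_tilde_eq: "beta_tilde M F X = expectation (cdf_gap M F X)"
proof -
  have "(\<integral>\<^sup>+\<omega>. ennreal (\<bar>cdf_gap M F X \<omega>\<bar> powr 1) \<partial>M) = (\<integral>\<^sup>+\<omega>. ennreal (cdf_gap M F X \<omega>) \<partial>M)"
    by (rule nn_integral_cong) (use cdf_gap_nonneg in auto)
  also have "\<dots> = ennreal (expectation (cdf_gap M F X))"
    by (rule nn_integral_eq_integral) (use cdf_gap_nonneg in auto)
  finally have "Lq_norm M 1 (cdf_gap M F X) = ennreal (expectation (cdf_gap M F X))"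
    using cdf_gap_nonneg by (simp add: Lq_norm_def Bochner_Integration.integral_nonneg)
  then show ?thesis
    using cdf_gap_nonneg unfolding beta_tilde_def cdf_gap_def[symmetric]
    by (simp add: Bochner_Integration.integral_nonneg)
qed

text \<open>For each t the essential supremum leaves an exceptional null set of its own. Only those
  of rational t are collected, and right continuity supplies the other t.\<close>

lemma AE_cdf_gap_le_phi_tilde: "AE \<omega> in M. cdf_gap M F X \<omega> \<le> phi_tilde M F X"
proof -
  let ?e = "\<lambda>t. esssup M (\<lambda>\<omega>. ennreal \<bar>cond_cdf_diff M F X t \<omega>\<bar>)"
  have "?e t \<le> 1" for t
    using cond_cdf_diff_bounded by (intro esssup_I AE_I2) (auto simp: ennreal_le_1)
  then have "(SUP t. ?e t) \<le> 1" by (intro SUP_least)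
  then have "(SUP t. ?e t) < \<top>" by (rule le_less_trans) simp
  then have phi: "ennreal (phi_tilde M F X) = (SUP t. ?e t)"
    unfolding phi_tilde_def Lq_norm_def by simp
  have "AE \<omega> in M. \<forall>q\<in>\<rat>. \<bar>cond_cdf_diff M F X q \<omega>\<bar> \<le> phi_tilde M F X"
  proof (intro AE_ball_countable' countable_rat)
    fix q :: real
    have "AE \<omega> in M. ennreal \<bar>cond_cdf_diff M F X q \<omega>\<bar> \<le> ?e q" by (rule esssup_AE)
    then show "AE \<omega> in M. \<bar>cond_cdf_diff M F X q \<omega>\<bar> \<le> phi_tilde M F X"
    proof eventually_elim
      case (elim \<omega>)
      also have "?e q \<le> ennreal (phi_tilde M F X)" unfolding phi by (rule SUP_upper) simp
      finally show ?case by (simp add: phi_tilde_def)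
    qed
  qed
  with AE_space show ?thesis
    by eventually_elim (auto intro: cdf_gap_le)
qed

lemma prob_joint_le:
  assumes A: "A \<in> sets F" and J: "is_interval J"
  shows "prob (A \<inter> {\<omega> \<in> space M. X \<omega> \<in> J})
      \<le> prob A * prob {\<omega> \<in> space M. X \<omega> \<in> J} + 2 * expectation (\<lambda>\<omega>. indicator A \<omega> * cdf_gap M F X \<omega>)"
proof -
  interpret finite_measure_subalgebra M F by standard (rule sub)
  have JB [measurable]: "J \<in> sets borel" by (rule real_interval_borel_measurable[OF J])
  have AM [measurable]: "A \<in> sets M" using A sub by (auto simp: subalgebra_def)
  have [measurable]: "(\<lambda>\<omega>. measure (cond_law \<omega>) J) \<in> borel_measurable M"
    by (rule measurable_from_subalg[OF sub regular_cond_distr_measure_measurable]) simp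
  let ?f = "indicator (X -` J \<inter> space M) :: 'a \<Rightarrow> real"
  have XJ: "{\<omega> \<in> space M. X \<omega> \<in> J} = X -` J \<inter> space M" by auto
  have int: "integrable M (\<lambda>\<omega>. indicator A \<omega> * ?f \<omega>)"
    by (rule integrable_const_bound[where B = 1]) (auto simp: indicator_def)
  have intK: "integrable M (\<lambda>\<omega>. indicator A \<omega> * measure (cond_law \<omega>) J)"
  proof (rule integrable_const_bound[where B = 1])
    show "AE \<omega> in M. norm (indicator A \<omega> * measure (cond_law \<omega>) J) \<le> 1"
    proof (rule AE_I2)
      fix \<omega> assume "\<omega> \<in> space M"
      then interpret K: real_distribution "cond_law \<omega>" by (rule real_distribution_regular_cond_distr)
      show "norm (indicator A \<omega> * measure (cond_law \<omega>) J) \<le> 1" by (simp add: indicator_def)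
    qed
  qed simp
  have intA: "integrable M (\<lambda>\<omega>. indicator A \<omega> * prob (X -` J \<inter> space M))"
    by (intro integrable_mult_left integrable_const_bound[where B = 1]) auto
  have intg: "integrable M (\<lambda>\<omega>. indicator A \<omega> * cdf_gap M F X \<omega>)"
    using cdf_gap_nonneg cdf_gap_le_1
    by (intro integrable_const_bound[where B = 1]) (auto simp: indicator_def)
  have "prob (A \<inter> (X -` J \<inter> space M)) = expectation (\<lambda>\<omega>. indicator (A \<inter> (X -` J \<inter> space M)) \<omega> :: real)"
    by (simp add: Int_assoc)
  also have "\<dots> = expectation (\<lambda>\<omega>. indicator A \<omega> * ?f \<omega>)"
    by (simp only: indicator_inter_arith)
  also have "\<dots> = expectation (\<lambda>\<omega>. indicator A \<omega> * real_cond_exp M F ?f \<omega>)"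
    by (rule real_cond_exp_intg(2)[symmetric, OF int]) (use A in auto)
  also have "\<dots> = expectation (\<lambda>\<omega>. indicator A \<omega> * measure (cond_law \<omega>) J)"
    using regular_cond_distr_is_regular[OF sub X] JB unfolding is_regular_cond_distr_def
    by (intro integral_cong_AE) (auto elim!: ballE[of _ _ J])
  also have "\<dots> \<le> expectation (\<lambda>\<omega>. indicator A \<omega> * prob (X -` J \<inter> space M)
      + 2 * (indicator A \<omega> * cdf_gap M F X \<omega>))"
  proof (rule integral_mono)
    fix \<omega> assume w: "\<omega> \<in> space M"
    have "\<bar>measure (cond_law \<omega>) J - measure (distr M borel X) J\<bar> \<le> 2 * cdf_gap M F X \<omega>"
    proof (rule interval_discrepancy_le[OF real_distribution_regular_cond_distr[OF w] _ _ J])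
      show "\<bar>measure (cond_law \<omega>) {..t} - measure (distr M borel X) {..t}\<bar> \<le> cdf_gap M F X \<omega>" for t
        using cond_cdf_diff_le_gap[OF w, of t] by (simp add: cond_cdf_diff_eq cdf_def)
    qed simp
    then have "measure (cond_law \<omega>) J \<le> prob (X -` J \<inter> space M) + 2 * cdf_gap M F X \<omega>"
      by (simp add: measure_distr)
    then show "indicator A \<omega> * measure (cond_law \<omega>) J \<le> indicator A \<omega> * prob (X -` J \<inter> space M)
      + 2 * (indicator A \<omega> * cdf_gap M F X \<omega>)"
      by (auto simp: indicator_def)
  qed (use intK intg intA in \<open>auto intro!: Bochner_Integration.integrable_add\<close>)
  also have "\<dots> = prob A * prob (X -` J \<inter> space M) + 2 * expectation (\<lambda>\<omega>. indicator A \<omega> * cdf_gap M F X \<omega>)"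
    using intg intA by (subst Bochner_Integration.integral_add) auto
  finally show ?thesis by (simp add: XJ)
qed

end

text \<open>Expand the square. The diagonal contributes at most the mean, and the two orders of a
  pair give the factor 2. For fixed j the lag \<open>k - j\<close> determines k and lies in
  \<open>{1..<n}\<close>, so the sum over k is bounded by one over lags. Sparse index sets
  \<open>S\<close> are allowed for the sake of (i).\<close>

lemma expectation_square_count_le:
  fixes A :: "nat \<Rightarrow> 'a set" and c :: "nat \<Rightarrow> nat \<Rightarrow> real"
  assumes S: "S \<subseteq> {1..n}" and A: "\<And>k. k \<in> S \<Longrightarrow> A k \<in> events"
    and c: "\<And>j d. 0 \<le> c j d"
    and pair: "\<And>j k. j \<in> S \<Longrightarrow> k \<in> S \<Longrightarrow> j < k \<Longrightarrow>
      prob (A j \<inter> A k) \<le> prob (A j) * prob (A k) + c j (k - j)"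
  shows "expectation (\<lambda>\<omega>. ((\<Sum>k\<in>S. indicator (A k) \<omega>) - (\<Sum>k\<in>S. prob (A k)))\<^sup>2)
      \<le> (\<Sum>k\<in>S. prob (A k)) + 2 * (\<Sum>j\<in>S. \<Sum>d=1..<n. c j d)"
proof -
  have fin: "finite S" using S finite_subset by blast
  let ?Y = "\<lambda>k \<omega>. indicator (A k) \<omega> - prob (A k) :: real"
  have intA [simp]: "integrable M (indicator (A k) :: 'a \<Rightarrow> real)" if "k \<in> S" for k
    using A[OF that] by (intro integrable_const_bound[where B = 1]) auto
  have prod_eq: "?Y j \<omega> * ?Y k \<omega> = indicator (A j \<inter> A k) \<omega> - prob (A j) * indicator (A k) \<omega>
      - prob (A k) * indicator (A j) \<omega> + prob (A j) * prob (A k)" for j k \<omega>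
    by (simp add: indicator_inter_arith algebra_simps)
  have intAA [simp]: "integrable M (indicator (A j \<inter> A k) :: 'a \<Rightarrow> real)" if "j \<in> S" "k \<in> S" for j k
    using A[OF that(1)] A[OF that(2)] by (intro integrable_const_bound[where B = 1]) auto
  have int: "integrable M (\<lambda>\<omega>. ?Y j \<omega> * ?Y k \<omega>)" if "j \<in> S" "k \<in> S" for j k
    unfolding prod_eq using that by auto
  have E: "expectation (\<lambda>\<omega>. ?Y j \<omega> * ?Y k \<omega>) = prob (A j \<inter> A k) - prob (A j) * prob (A k)"
    if "j \<in> S" "k \<in> S" for j k
    unfolding prod_eq using that A[OF that(1)] A[OF that(2)] by (simp add: prob_space)
  have "expectation (\<lambda>\<omega>. ((\<Sum>k\<in>S. indicator (A k) \<omega>) - (\<Sum>k\<in>S. prob (A k)))\<^sup>2)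
      = expectation (\<lambda>\<omega>. \<Sum>j\<in>S. \<Sum>k\<in>S. ?Y j \<omega> * ?Y k \<omega>)"
    by (simp add: power2_eq_square sum_product sum_subtractf[symmetric])
  also have "\<dots> = (\<Sum>j\<in>S. \<Sum>k\<in>S. prob (A j \<inter> A k) - prob (A j) * prob (A k))"
    using int E by (simp add: Bochner_Integration.integral_sum)
  also have "\<dots> \<le> (\<Sum>j\<in>S. \<Sum>k\<in>S. (if j = k then prob (A k) else 0)
      + ((if j < k then c j (k - j) else 0) + (if k < j then c k (j - k) else 0)))"
  proof (intro sum_mono)
    fix j k assume jk: "j \<in> S" "k \<in> S"
    show "prob (A j \<inter> A k) - prob (A j) * prob (A k) \<le> (if j = k then prob (A k) else 0)
      + ((if j < k then c j (k - j) else 0) + (if k < j then c k (j - k) else 0))"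
      using pair[OF jk] pair[OF jk(2,1)]
      by (cases j k rule: linorder_cases) (auto simp: Int_commute mult.commute)
  qed
  also have "\<dots> = (\<Sum>k\<in>S. prob (A k)) + 2 * (\<Sum>j\<in>S. \<Sum>k\<in>S. if j < k then c j (k - j) else 0)"
    using fin sum.swap[of "\<lambda>j k. if k < j then c k (j - k) else 0" S S]
    by (simp add: sum.distrib)
  also have "(\<Sum>j\<in>S. \<Sum>k\<in>S. if j < k then c j (k - j) else 0) \<le> (\<Sum>j\<in>S. \<Sum>d=1..<n. c j d)"
  proof (rule sum_mono)
    fix j assume j: "j \<in> S"
    have "(\<Sum>k\<in>S. if j < k then c j (k - j) else 0) = (\<Sum>k\<in>{k\<in>S. j < k}. c j (k - j))"
      using fin by (simp add: sum.inter_filter)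
    also have "\<dots> = (\<Sum>d\<in>(\<lambda>k. k - j) ` {k\<in>S. j < k}. c j d)"
      by (subst sum.reindex) (auto simp: inj_on_def)
    also have "\<dots> \<le> (\<Sum>d=1..<n. c j d)"
    proof (rule sum_mono2)
      show "(\<lambda>k. k - j) ` {k\<in>S. j < k} \<subseteq> {1..<n}"
      proof
        fix d assume "d \<in> (\<lambda>k. k - j) ` {k\<in>S. j < k}"
        then obtain k where "d = k - j" "k \<in> S" "j < k" by blast
        moreover have "1 \<le> j" "k \<le> n" using S j \<open>k \<in> S\<close> by auto
        ultimately show "d \<in> {1..<n}" by auto
      qed
    qed (use c in auto)
    finally show "(\<Sum>k\<in>S. if j < k then c j (k - j) else 0) \<le> (\<Sum>d=1..<n. c j d)" .
  qed
  finally show ?thesis by simp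
qed

end

section \<open>Second moment criteria\<close>

lemma Lq_norm_1: "Lq_norm M 1 f = (\<integral>\<^sup>+\<omega>. ennreal \<bar>f \<omega>\<bar> \<partial>M)"
  by (cases "\<integral>\<^sup>+\<omega>. ennreal \<bar>f \<omega>\<bar> \<partial>M") (simp_all add: Lq_norm_def Let_def)

context prob_space
begin



lemma integrable_count_square:
  assumes "\<And>k. k \<in> S \<Longrightarrow> A k \<in> events" "finite S"
  shows "integrable M (\<lambda>\<omega>. ((\<Sum>k\<in>S. indicator (A k) \<omega>) - c)\<^sup>2 :: real)"
proof (rule integrable_const_bound[where B = "(real (card S) + \<bar>c\<bar>)\<^sup>2"])
  have "\<bar>(\<Sum>k\<in>S. indicator (A k) \<omega>) - c\<bar> \<le> \<bar>real (card S) + \<bar>c\<bar>\<bar>" for \<omega>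
  proof -
    have "(\<Sum>k\<in>S. indicator (A k) \<omega>) \<le> (\<Sum>k\<in>S. 1 :: real)" by (intro sum_mono) simp
    moreover have "0 \<le> (\<Sum>k\<in>S. indicator (A k) \<omega> :: real)" by (intro sum_nonneg) simp
    ultimately show ?thesis by (simp only: sum_constant)
  qed
  then show "AE \<omega> in M. norm (((\<Sum>k\<in>S. indicator (A k) \<omega>) - c)\<^sup>2) \<le> (real (card S) + \<bar>c\<bar>)\<^sup>2"
    by (intro AE_I2) (simp only: abs_le_square_iff real_norm_def abs_power2)
qed (use assms in auto)

context
  fixes B :: "nat \<Rightarrow> 'a set" and E :: "nat \<Rightarrow> real"
  assumes B: "\<And>k. k > 0 \<Longrightarrow> B k \<in> events"
    and E: "\<And>n. E n = (\<Sum>k=1..n. prob (B k))"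
begin

lemma expected_count_eq: "expected_count M B n = E n"
proof -
  have "expected_count M B n = (\<Sum>k=1..n. expectation (indicator (B k)))"
    unfolding expected_count_def partial_count_def
    using B by (intro Bochner_Integration.integral_sum) (auto intro!: integrable_const_bound[where B = 1])
  also have "\<dots> = E n"
    unfolding E using B by (intro sum.cong) auto
  finally show ?thesis .
qed

lemma expected_count_mono: "m \<le> n \<Longrightarrow> E m \<le> E n"
  unfolding E by (intro sum_mono2) auto

lemma partial_count_mono: "m \<le> n \<Longrightarrow> partial_count B m \<omega> \<le> partial_count B n \<omega>"
  unfolding partial_count_def by (intro sum_mono2) auto

lemma partial_count_measurable [measurable]: "partial_count B n \<in> borel_measurable M"
  unfolding partial_count_def using B by measurable

lemma partial_count_square_integrable: "integrable M (\<lambda>\<omega>. (partial_count B n \<omega> - c)\<^sup>2)"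
  unfolding partial_count_def by (rule integrable_count_square) (use B in auto)

lemma expectation_square_ratio_le:
  assumes "E n > 0" and var: "expectation (\<lambda>\<omega>. (partial_count B n \<omega> - E n)\<^sup>2) \<le> E n * G"
  shows "integrable M (\<lambda>\<omega>. (partial_count B n \<omega> / E n - 1)\<^sup>2)"
    and "expectation (\<lambda>\<omega>. (partial_count B n \<omega> / E n - 1)\<^sup>2) \<le> G / E n"
proof -
  have eq: "(\<lambda>\<omega>. (partial_count B n \<omega> / E n - 1)\<^sup>2) = (\<lambda>\<omega>. (partial_count B n \<omega> - E n)\<^sup>2 / (E n)\<^sup>2)"
    using \<open>E n > 0\<close> by (auto simp: power_divide[symmetric] diff_divide_distrib)
  show "integrable M (\<lambda>\<omega>. (partial_count B n \<omega> / E n - 1)\<^sup>2)"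
    unfolding eq using partial_count_square_integrable by simp
  have "expectation (\<lambda>\<omega>. (partial_count B n \<omega> - E n)\<^sup>2) / (E n)\<^sup>2 \<le> E n * G / (E n)\<^sup>2"
    using var by (rule divide_right_mono) simp
  then show "expectation (\<lambda>\<omega>. (partial_count B n \<omega> / E n - 1)\<^sup>2) \<le> G / E n"
    unfolding eq using \<open>E n > 0\<close> by (simp add: power2_eq_square)
qed

lemma expected_count_tendsto:
  assumes "(\<Sum>k. emeasure M (B (Suc k))) = \<infinity>"
  shows "filterlim E at_top sequentially"
proof -
  have "\<not> summable (\<lambda>k. prob (B (Suc k)))"
  proof
    assume "summable (\<lambda>k. prob (B (Suc k)))"
    then have "(\<Sum>k. ennreal (prob (B (Suc k)))) \<noteq> \<top>"
      by (simp add: suminf_ennreal2)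
    then show False using assms by (simp add: emeasure_eq_measure)
  qed
  have unb: "\<exists>n. Z < E n" for Z
  proof (rule ccontr)
    assume "\<nexists>n. Z < E n"
    then have "E (Suc n) \<le> Z" for n by (simp add: not_less)
    moreover have "E (Suc n) = (\<Sum>k\<le>n. prob (B (Suc k)))" for n
      by (induction n) (simp_all add: E)
    ultimately have "(\<Sum>k\<le>n. prob (B (Suc k))) \<le> Z" for n by simp
    then have "summable (\<lambda>k. prob (B (Suc k)))"
      by (intro bounded_imp_summable[where B = Z]) auto
    with \<open>\<not> summable _\<close> show False by simp
  qed
  show ?thesis
    unfolding filterlim_at_top_dense eventually_sequentially
  proof
    fix Z
    obtain n where "Z < E n" using unb by blast
    then show "\<exists>N. \<forall>n\<ge>N. Z < E n" using expected_count_mono by (meson less_le_trans)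
  qed
qed

lemma L1_borel_cantelli_of_variance:
  assumes div: "(\<Sum>k. emeasure M (B (Suc k))) = \<infinity>"
    and var: "\<And>n. n > 0 \<Longrightarrow> expectation (\<lambda>\<omega>. (partial_count B n \<omega> - E n)\<^sup>2) \<le> E n * G n"
    and lim: "(\<lambda>n. G n / E n) \<longlonglongrightarrow> 0"
  shows "L1_borel_cantelli_seq M B"
proof -
  note Elim = expected_count_tendsto[OF div]
  have "\<forall>\<^sub>F n in sequentially. 0 < E n" using Elim by (simp add: filterlim_at_top_dense)
  then have bound: "\<forall>\<^sub>F n in sequentially.
      Lq_norm M 1 (\<lambda>\<omega>. partial_count B n \<omega> / expected_count M B n - 1) \<le> ennreal (sqrt (G n / E n))"
    using eventually_gt_at_top[of 0]
  proof eventually_elim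
    case (elim n)
    let ?Y = "\<lambda>\<omega>. partial_count B n \<omega> / E n - 1"
    note Y2 = expectation_square_ratio_le[OF elim(1) var[OF elim(2)]]
    have intY: "integrable M (\<lambda>\<omega>. \<bar>?Y \<omega>\<bar>)"
      by (rule square_integrable_imp_integrable) (use Y2 in auto)
    \<comment> \<open>The L^1 norm is bounded by the L^2 norm because the variance of
      \<open>\<bar>?Y\<bar>\<close> is nonnegative.\<close>
    have "(expectation (\<lambda>\<omega>. \<bar>?Y \<omega>\<bar>))\<^sup>2 \<le> expectation (\<lambda>\<omega>. (\<bar>?Y \<omega>\<bar>)\<^sup>2)"
      using variance_positive[of "\<lambda>\<omega>. \<bar>?Y \<omega>\<bar>"] variance_eq[OF intY] Y2 by simp
    also have "\<dots> \<le> G n / E n" using Y2 by simp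
    finally have "expectation (\<lambda>\<omega>. \<bar>?Y \<omega>\<bar>) \<le> sqrt (G n / E n)" by (rule real_le_rsqrt)
    moreover have "Lq_norm M 1 ?Y = ennreal (expectation (\<lambda>\<omega>. \<bar>?Y \<omega>\<bar>))"
      unfolding Lq_norm_1 by (rule nn_integral_eq_integral[OF intY]) simp
    ultimately show ?case by (simp add: expected_count_eq ennreal_leI)
  qed
  have "(\<lambda>n. ennreal (sqrt (G n / E n))) \<longlonglongrightarrow> ennreal (sqrt 0)"
    by (intro tendsto_ennrealI tendsto_real_sqrt lim)
  then have "(\<lambda>n. Lq_norm M 1 (\<lambda>\<omega>. partial_count B n \<omega> / expected_count M B n - 1)) \<longlonglongrightarrow> 0"
    by (intro tendsto_sandwich[OF _ bound tendsto_const]) auto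
  with div show ?thesis by (simp add: L1_borel_cantelli_seq_def)
qed

lemma strongly_borel_cantelli_of_variance:
  assumes div: "(\<Sum>k. emeasure M (B (Suc k))) = \<infinity>" and pos: "prob (B 1) > 0"
    and var: "\<And>n. n > 0 \<Longrightarrow> expectation (\<lambda>\<omega>. (partial_count B n \<omega> - E n)\<^sup>2) \<le> E n * G n"
    and sum: "summable (\<lambda>n. prob (B (Suc n)) / (E (Suc n))\<^sup>2 * G (Suc n))"
  shows "strongly_borel_cantelli_seq M B"
proof -
  have Epos: "0 < E n" if "n > 0" for n
  proof -
    have "E 1 \<le> E n" using that by (intro expected_count_mono) simp
    then show ?thesis using pos by (simp add: E)
  qed
  have Estep: "E (Suc n) = E n + prob (B (Suc n))" for n by (simp add: E)
  \<comment> \<open>The weight is the relative increment of \<open>E\<close>, as in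
    \<open>increasing_ratio_tendsto_1\<close>; its denominator and that of the variance ratio
    together form the \<open>(E (Suc n))\<^sup>2\<close> in \<open>sum\<close>.\<close>
  let ?h = "\<lambda>n \<omega>. prob (B (Suc n)) / E (Suc n) * (partial_count B (Suc n) \<omega> / E (Suc n) - 1)\<^sup>2"
  have h0: "0 \<le> ?h n \<omega>" for n \<omega> using Epos[of "Suc n"] by simp
  have "(\<integral>\<^sup>+\<omega>. ennreal (?h n \<omega>) \<partial>M) \<le> ennreal (prob (B (Suc n)) / (E (Suc n))\<^sup>2 * G (Suc n))" for n
  proof -
    note Y2 = expectation_square_ratio_le[OF Epos[of "Suc n"] var[of "Suc n"], simplified]
    have "(\<integral>\<^sup>+\<omega>. ennreal (?h n \<omega>) \<partial>M) = ennreal (expectation (?h n))"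
      by (rule nn_integral_eq_integral) (use Y2 h0 in auto)
    also have "expectation (?h n) \<le> prob (B (Suc n)) / E (Suc n) * (G (Suc n) / E (Suc n))"
      using Y2 Epos[of "Suc n"] by (simp add: mult_left_mono del: times_divide_eq_left times_divide_eq_right)
    finally show ?thesis by (simp add: power2_eq_square ennreal_leI)
  qed
  then have "(\<Sum>n. \<integral>\<^sup>+\<omega>. ennreal (?h n \<omega>) \<partial>M)
      \<le> (\<Sum>n. ennreal (prob (B (Suc n)) / (E (Suc n))\<^sup>2 * G (Suc n)))"
    by (intro suminf_le) auto
  also have "\<dots> < \<infinity>"
  proof -
    \<comment> \<open>The sign of \<open>G\<close> can be read off \<open>var\<close>, since a mean
      square is nonnegative. It is needed to compare the \<open>ennreal\<close> series with the real
      one.\<close>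
    have "0 \<le> G (Suc n)" for n
    proof -
      have "0 \<le> expectation (\<lambda>\<omega>. (partial_count B (Suc n) \<omega> - E (Suc n))\<^sup>2)"
        by (rule Bochner_Integration.integral_nonneg) simp
      also have "\<dots> \<le> E (Suc n) * G (Suc n)" by (rule var) simp
      finally show ?thesis using Epos[of "Suc n"] by (simp add: zero_le_mult_iff)
    qed
    then show ?thesis
      by (subst suminf_ennreal2[OF _ sum]) simp_all
  qed
  finally have "(\<integral>\<^sup>+\<omega>. (\<Sum>n. ennreal (?h n \<omega>)) \<partial>M) \<noteq> \<infinity>"
    by (subst nn_integral_suminf) auto
  then have "AE \<omega> in M. (\<Sum>n. ennreal (?h n \<omega>)) \<noteq> \<infinity>"
    by (intro nn_integral_PInf_AE) auto
  then have "AE \<omega> in M. (\<lambda>n. partial_count B n \<omega> / E n) \<longlonglongrightarrow> 1"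
  proof eventually_elim
    case (elim \<omega>)
    have summ: "summable (\<lambda>n. ?h n \<omega>)"
      by (rule summable_suminf_not_top) (use h0 elim in auto)
    show ?case
    proof (rule increasing_ratio_tendsto_1)
      show "incseq (\<lambda>n. partial_count B n \<omega>)" by (auto simp: incseq_def partial_count_mono)
      show "incseq E" by (auto simp: incseq_def expected_count_mono)
      show "0 \<le> partial_count B n \<omega>" for n by (auto simp: partial_count_def intro: sum_nonneg)
      show "0 \<le> E 0" by (simp add: E)
      show "filterlim E at_top sequentially" by (rule expected_count_tendsto[OF div])
      show "summable (\<lambda>n. (E (Suc n) - E n) / E (Suc n) * (partial_count B (Suc n) \<omega> / E (Suc n) - 1)\<^sup>2)"
        using summ by (simp add: Estep)
    qed (use Epos in \<open>auto simp: Estep\<close>)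
  qed
  with div show ?thesis by (simp add: strongly_borel_cantelli_seq_def expected_count_eq)
qed

end

end

section \<open>Interval covers, conjugate exponents and weighted sums\<close>

text \<open>In a minimal subfamily, all intervals through x lie in the union of the one reaching furthest
  left and the one reaching furthest right.\<close>

lemma finite_intervals_cover_overlap_le_2:
  fixes I :: "nat \<Rightarrow> real set"
  assumes S: "finite S" and I: "\<And>j. j \<in> S \<Longrightarrow> is_interval (I j)"
  shows "\<exists>T\<subseteq>S. (\<Union>j\<in>T. I j) = (\<Union>j\<in>S. I j) \<and> (\<forall>x. card {j\<in>T. x \<in> I j} \<le> 2)"
proof -
  let ?P = "\<lambda>T. T \<subseteq> S \<and> (\<Union>j\<in>T. I j) = (\<Union>j\<in>S. I j)"
  obtain T where T: "?P T" and min: "\<And>T'. ?P T' \<Longrightarrow> card T \<le> card T'"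
    using ex_has_least_nat[of ?P S card] by auto
  have finT: "finite T" using T S finite_subset by blast
  have irredundant: "\<not> I j \<subseteq> (\<Union>i\<in>T - {j}. I i)" if "j \<in> T" for j
  proof
    assume "I j \<subseteq> (\<Union>i\<in>T - {j}. I i)"
    then have "(\<Union>i\<in>T - {j}. I i) = (\<Union>i\<in>T. I i)" using that by blast
    then have "card T \<le> card (T - {j})" using T by (intro min) auto
    then show False using card_Diff1_less[OF finT that] by linarith
  qed
  have "card {j\<in>T. x \<in> I j} \<le> 2" for x
  proof (cases "{j\<in>T. x \<in> I j} = {}")
    case False
    let ?J = "{j\<in>T. x \<in> I j}"
    \<comment> \<open>The parts of the intervals on one side of x form a finite chain, which has a
      largest member.\<close>
    have top: "\<exists>j\<in>?J. \<forall>i\<in>?J. g i \<subseteq> g j"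
      if lin: "\<And>i j. i \<in> ?J \<Longrightarrow> j \<in> ?J \<Longrightarrow> g i \<subseteq> g j \<or> g j \<subseteq> g i" for g :: "nat \<Rightarrow> real set"
    proof -
      obtain m where m: "m \<in> g ` ?J" "\<And>b. b \<in> g ` ?J \<Longrightarrow> m \<subseteq> b \<Longrightarrow> m = b"
        using finite_has_maximal[of "g ` ?J"] finT False by auto
      then obtain j where j: "j \<in> ?J" "m = g j" by blast
      have "g i \<subseteq> g j" if "i \<in> ?J" for i
        using lin[OF that j(1)] m(2)[of "g i"] j that by blast
      with j show ?thesis by blast
    qed
    \<comment> \<open>If neither part contained the other, each interval would have a point to the
      left of x missing from the other. The one of these points nearer to x lies between x and the
      farther one, hence in both intervals.\<close>
    have left: "I i \<inter> {..x} \<subseteq> I j \<inter> {..x} \<or> I j \<inter> {..x} \<subseteq> I i \<inter> {..x}"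
      if "i \<in> ?J" "j \<in> ?J" for i j
    proof (rule ccontr)
      assume "\<not> ?thesis"
      then obtain y z where yz: "y \<in> I i" "y \<notin> I j" "z \<in> I j" "z \<notin> I i" "y \<le> x" "z \<le> x" by blast
      have ij: "is_interval (I i)" "is_interval (I j)" "x \<in> I i" "x \<in> I j" using that T I by auto
      show False
      proof (cases "y \<le> z")
        case True
        then show ?thesis using ij yz unfolding is_interval_1 by blast
      next
        case False
        then have "z \<le> y" by simp
        then show ?thesis using ij yz unfolding is_interval_1 by blast
      qed
    qed
    have right: "I i \<inter> {x..} \<subseteq> I j \<inter> {x..} \<or> I j \<inter> {x..} \<subseteq> I i \<inter> {x..}"
      if "i \<in> ?J" "j \<in> ?J" for i j
    proof (rule ccontr)
      assume "\<not> ?thesis"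
      then obtain y z where yz: "y \<in> I i" "y \<notin> I j" "z \<in> I j" "z \<notin> I i" "x \<le> y" "x \<le> z" by blast
      have ij: "is_interval (I i)" "is_interval (I j)" "x \<in> I i" "x \<in> I j" using that T I by auto
      show False
      proof (cases "y \<le> z")
        case True
        then show ?thesis using ij yz unfolding is_interval_1 by blast
      next
        case False
        then have "z \<le> y" by simp
        then show ?thesis using ij yz unfolding is_interval_1 by blast
      qed
    qed
    obtain l where l: "l \<in> ?J" "\<And>i. i \<in> ?J \<Longrightarrow> I i \<inter> {..x} \<subseteq> I l \<inter> {..x}"
      using top[of "\<lambda>i. I i \<inter> {..x}"] left by blast
    obtain r where r: "r \<in> ?J" "\<And>i. i \<in> ?J \<Longrightarrow> I i \<inter> {x..} \<subseteq> I r \<inter> {x..}"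
      using top[of "\<lambda>i. I i \<inter> {x..}"] right by blast
    \<comment> \<open>Any further interval through x would be covered by \<open>I l\<close> and
      \<open>I r\<close>, against irredundancy.\<close>
    have "?J \<subseteq> {l, r}"
    proof
      fix j assume j: "j \<in> ?J"
      have "I j \<subseteq> I l \<union> I r"
      proof
        fix y assume "y \<in> I j"
        then show "y \<in> I l \<union> I r" using l(2)[OF j] r(2)[OF j] linear[of y x] by auto
      qed
      then show "j \<in> {l, r}" using irredundant[of j] j l(1) r(1) by blast
    qed
    then have "card ?J \<le> card {l, r}" by (intro card_mono) auto
    also have "\<dots> \<le> 2" by (simp add: card_insert_if)
    finally show ?thesis .
  next
    case True
    then show ?thesis by (simp only: card.empty)
  qed
  with T show ?thesis by blast
qed

lemma conjugate_exponent_cases: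
  fixes p :: real and q :: ennreal
  assumes p: "p \<ge> 1" and pq: "1 / ennreal p + 1 / q = 1"
  obtains "p = 1" "q = \<infinity>" | r where "q = ennreal r" "p > 1" "r > 1" "1 / p + 1 / r = 1"
proof (cases q)
  case (real r)
  have p1: "1 / ennreal p = ennreal (1 / p)"
    using divide_ennreal[of 1 p] p by simp
  \<comment> \<open>In \<open>ennreal\<close>, 1 / 0 is infinite, so the equation itself excludes a
    zero exponent.\<close>
  have "r \<noteq> 0" using pq real by auto
  then have r: "r > 0" using real by simp
  then have "1 / q = ennreal (1 / r)"
    using divide_ennreal[of 1 r] real by simp
  then have "ennreal (1 / p + 1 / r) = ennreal 1"
    using pq p1 p r by simp
  then have eq: "1 / p + 1 / r = 1"
    using p r by (subst (asm) ennreal_inj) auto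
  have "0 < 1 / r" "0 < 1 / p" using r p by auto
  then have "1 / p < 1" "1 / r < 1" using eq by linarith+
  then have "p > 1" "r > 1" using p r by auto
  then show ?thesis using that(2)[of r] real eq by simp
next
  case top
  then have "1 / ennreal p = 1" using pq by simp
  then have "ennreal (1 / p) = ennreal 1"
    using divide_ennreal[of 1 p] p by simp
  then have "1 / p = 1" using p by (subst (asm) ennreal_inj) auto
  then have "p = 1" by simp
  then show ?thesis using that(1) top by simp
qed

text \<open>\<open>Lq_norm\<close> is infinite when the integral is, so a finite bound rules out the
  case in which \<open>enn2real\<close> would return its default 0.\<close>

lemma Lq_norm_le_imp_nn_integral_le:
  assumes r: "r > 0" and a: "a \<ge> 0" and le: "Lq_norm M (ennreal r) f \<le> ennreal a"
  shows "(\<integral>\<^sup>+\<omega>. ennreal (\<bar>f \<omega>\<bar> powr r) \<partial>M) \<le> ennreal (a powr r)"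
proof -
  define J where "J = (\<integral>\<^sup>+\<omega>. ennreal (\<bar>f \<omega>\<bar> powr r) \<partial>M)"
  have "J \<noteq> \<infinity>" using le r by (auto simp: Lq_norm_def J_def[symmetric] top_unique)
  then obtain j where j: "J = ennreal j" "0 \<le> j" by (cases J) auto
  have "ennreal (j powr (1 / r)) \<le> ennreal a"
    using le r j by (auto simp: Lq_norm_def J_def[symmetric])
  then have "j powr (1 / r) \<le> a" using a by (simp add: ennreal_le_iff)
  then have "(j powr (1 / r)) powr r \<le> a powr r" using r by (intro powr_mono2) auto
  then have "j \<le> a powr r" using r j by (simp add: powr_powr)
  then show ?thesis using j by (simp add: J_def[symmetric] ennreal_leI)
qed

text \<open>The weights are dominated by the differences of \<open>1 / E\<close>. Exchanging the two
  summations therefore leaves a weight of about \<open>1 / E d\<close> at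
  \<open>\<phi> d\<close>.\<close>

lemma summable_weighted_partial_sums:
  fixes \<phi> E :: "nat \<Rightarrow> real"
  assumes E: "\<And>n. n > 0 \<Longrightarrow> E n > 0" and mono: "\<And>n. E n \<le> E (Suc n)"
    and \<phi>: "\<And>d. 0 \<le> \<phi> d" and sum: "summable (\<lambda>n. 1 / E (Suc n) * \<phi> (Suc n))"
  shows "summable (\<lambda>n. (E (Suc n) - E n) / (E (Suc n))\<^sup>2 * (\<Sum>d=1..<Suc n. \<phi> d))"
proof -
  define w where "w n = (E (Suc n) - E n) / (E (Suc n))\<^sup>2" for n
  define \<Phi> where "\<Phi> n = (\<Sum>d=1..<Suc n. \<phi> d)" for n
  have \<Phi>0: "0 \<le> \<Phi> n" for n unfolding \<Phi>_def by (intro sum_nonneg \<phi>)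
  have w0: "0 \<le> w n" for n using mono[of n] by (simp add: w_def)
  have w: "w n \<le> 1 / E n - 1 / E (Suc n)" if "n > 0" for n
  proof -
    have pos: "E n > 0" "E (Suc n) > 0" using E that by auto
    have "w n \<le> (E (Suc n) - E n) / (E n * E (Suc n))"
      unfolding w_def power2_eq_square using pos mono[of n]
      by (intro divide_left_mono mult_right_mono) auto
    also have "\<dots> = 1 / E n - 1 / E (Suc n)" using pos by (simp add: field_simps)
    finally show ?thesis .
  qed
  \<comment> \<open>summation by parts: the boundary term makes the induction go through\<close>
  have abel: "(\<Sum>n<N. w n * \<Phi> n) + \<Phi> N / E N \<le> (\<Sum>n<N. 1 / E (Suc n) * \<phi> (Suc n))" for N
  proof (induction N)
    case 0
    then show ?case by (simp add: \<Phi>_def)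
  next
    case (Suc N)
    have "w N * \<Phi> N \<le> \<Phi> N / E N - \<Phi> N / E (Suc N)"
    \<comment> \<open>\<open>E 0\<close> may be zero, so the telescoping bound starts at 1; at 0 the
      sum \<open>\<Phi> 0\<close> is empty.\<close>
    proof (cases "N = 0")
      case False
      then show ?thesis
        using mult_right_mono[OF w[of N] \<Phi>0[of N]] by (simp add: left_diff_distrib)
    qed (simp add: \<Phi>_def)
    moreover have "\<Phi> (Suc N) = \<Phi> N + \<phi> (Suc N)" by (simp add: \<Phi>_def)
    ultimately show ?case using Suc by (simp add: add_divide_distrib)
  qed
  have "summable (\<lambda>n. w n * \<Phi> n)"
  proof (rule bounded_imp_summable)
    show "0 \<le> w n * \<Phi> n" for n using w0 \<Phi>0 by simp
    fix N
    have "(\<Sum>n\<le>N. w n * \<Phi> n) \<le> (\<Sum>n<Suc N. w n * \<Phi> n) + \<Phi> (Suc N) / E (Suc N)"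
      using \<Phi>0[of "Suc N"] E[of "Suc N"] by (simp add: lessThan_Suc_atMost)
    also have "\<dots> \<le> (\<Sum>n<Suc N. 1 / E (Suc n) * \<phi> (Suc n))" by (rule abel)
    also have "\<dots> \<le> (\<Sum>n. 1 / E (Suc n) * \<phi> (Suc n))"
      using E \<phi> by (intro sum_le_suminf[OF sum]) (auto intro!: divide_nonneg_pos)
    finally show "(\<Sum>n\<le>N. w n * \<Phi> n) \<le> (\<Sum>n. 1 / E (Suc n) * \<phi> (Suc n))" .
  qed
  then show ?thesis by (simp add: w_def \<Phi>_def)
qed

text \<open>Shift invariance of the law of the whole path, evaluated on a cylinder set of two
  coordinates.\<close>

lemma (in prob_space) stationary_joint_prob:
  assumes st: "strictly_stationary M X" and [measurable]: "A \<in> sets borel" "C \<in> sets borel"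
  shows "prob {\<omega> \<in> space M. X h \<omega> \<in> A \<and> X (d + h) \<omega> \<in> C}
    = prob {\<omega> \<in> space M. X 0 \<omega> \<in> A \<and> X d \<omega> \<in> C}"
proof -
  let ?P = "\<Pi>\<^sub>M i\<in>UNIV :: int set. borel :: real measure"
  let ?T = "{f \<in> space ?P. f 0 \<in> A \<and> f d \<in> C}"
  have [measurable]: "X i \<in> borel_measurable M" for i
    using st by (simp add: strictly_stationary_def)
  have sh: "(\<lambda>\<omega> i. X (i + h) \<omega>) \<in> M \<rightarrow>\<^sub>M ?P" for h
    by (rule measurable_abs_UNIV) simp
  have T: "?T \<in> sets ?P" by measurable
  have "measure (distr M ?P (\<lambda>\<omega> i. X (i + h) \<omega>)) ?T = measure (distr M ?P (\<lambda>\<omega> i. X (i + 0) \<omega>)) ?T"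
    using st by (simp add: strictly_stationary_def)
  then show ?thesis
    unfolding measure_distr[OF sh T]
    by (simp add: space_PiM vimage_def Int_def conj_commute)
qed

section \<open>Stationary sequences\<close>

locale stationary_interval_hits = prob_space M for M :: "'a measure" +
  fixes X :: "int \<Rightarrow> 'a \<Rightarrow> real" and \<mu> :: "real measure"
    and I :: "nat \<Rightarrow> real set" and B :: "nat \<Rightarrow> 'a set" and E :: "nat \<Rightarrow> real"
  assumes stationary: "strictly_stationary M X"
    and law: "\<And>i. distr M borel (X i) = \<mu>"
    and interval: "\<And>k. k > 0 \<Longrightarrow> is_interval (I k)"
    and first_pos: "measure \<mu> (I 1) > 0"
    and divergent: "(\<Sum>k. emeasure \<mu> (I (Suc k))) = \<infinity>"
    and B_def: "\<And>k. k > 0 \<Longrightarrow> B k = {\<omega> \<in> space M. X (int k) \<omega> \<in> I k}"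
    and E_def: "\<And>n. E n = (\<Sum>k=1..n. measure \<mu> (I k))"
begin

definition gap :: "nat \<Rightarrow> 'a \<Rightarrow> real" where
  "gap d = cdf_gap M (sigma_gen M (X 0)) (X (int d))"

text \<open>A pair of hits is shifted so that the earlier one takes place at time 0. All
  conditioning is then on the single sigma-field of \<open>X 0\<close>.\<close>

definition hit0 :: "nat \<Rightarrow> 'a set" where
  "hit0 j = {\<omega> \<in> space M. X 0 \<omega> \<in> I j}"

lemma X_measurable [measurable]: "X i \<in> borel_measurable M"
  using stationary by (simp add: strictly_stationary_def)

lemma interval_borel: "k > 0 \<Longrightarrow> I k \<in> sets borel"
  using interval real_interval_borel_measurable by blast

lemma subalgebra_sigma_gen: "subalgebra M (sigma_gen M (X i))"
  using X_measurable[of i] unfolding measurable_iff_sets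
  by (simp add: subalgebra_def sigma_gen_def)

lemma prob_X: "A \<in> sets borel \<Longrightarrow> prob {\<omega> \<in> space M. X i \<omega> \<in> A} = measure \<mu> A"
  unfolding law[of i, symmetric]
  by (subst measure_distr) (auto intro!: arg_cong[where f = prob])

lemma B_events: "k > 0 \<Longrightarrow> B k \<in> events"
  using interval_borel[of k] by (simp add: B_def)

lemma hit0_events: "j > 0 \<Longrightarrow> hit0 j \<in> events"
  using interval_borel[of j] by (simp add: hit0_def)

lemma hit0_sigma_gen: "j > 0 \<Longrightarrow> hit0 j \<in> sets (sigma_gen M (X 0))"
  unfolding hit0_def sigma_gen_def using in_vimage_algebra[OF interval_borel[of j], of "X 0" "space M"]
  by (simp add: vimage_def Int_def conj_commute)

lemma prob_B: "k > 0 \<Longrightarrow> prob (B k) = measure \<mu> (I k)"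
  using prob_X[OF interval_borel[of k]] by (simp add: B_def)

lemma prob_hit0: "k > 0 \<Longrightarrow> prob (hit0 k) = measure \<mu> (I k)"
  using prob_X[OF interval_borel[of k]] by (simp add: hit0_def)

lemma E_eq: "E n = (\<Sum>k=1..n. prob (B k))"
  unfolding E_def by (intro sum.cong) (auto simp: prob_B)

lemma divergent_B: "(\<Sum>k. emeasure M (B (Suc k))) = \<infinity>"
proof -
  interpret \<mu>: prob_space \<mu> unfolding law[of 0, symmetric] by (rule prob_space_distr) simp
  have "emeasure M (B (Suc k)) = emeasure \<mu> (I (Suc k))" for k
    using prob_B[of "Suc k"] by (simp add: emeasure_eq_measure \<mu>.emeasure_eq_measure)
  then show ?thesis using divergent by simp
qed

lemma E_pos: "n > 0 \<Longrightarrow> E n > 0"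
proof -
  assume "n > 0"
  then have "E 1 \<le> E n" unfolding E_def by (intro sum_mono2) auto
  then show ?thesis using first_pos by (simp add: E_def)
qed

lemma E_Suc: "E (Suc n) = E n + measure \<mu> (I (Suc n))"
  by (simp add: E_def)

lemma E_tendsto: "filterlim E at_top sequentially"
  by (rule expected_count_tendsto[OF _ E_eq divergent_B]) (rule B_events)

lemmas gap_facts = cdf_gap_measurable[OF subalgebra_sigma_gen X_measurable]
    cdf_gap_nonneg[OF subalgebra_sigma_gen X_measurable]
    cdf_gap_le_1[OF subalgebra_sigma_gen X_measurable]

lemma gap_measurable [measurable]: "gap d \<in> borel_measurable M"
  unfolding gap_def by (rule gap_facts)

lemma gap_nonneg: "\<omega> \<in> space M \<Longrightarrow> 0 \<le> gap d \<omega>"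
  unfolding gap_def by (rule gap_facts)

lemma gap_le_1: "\<omega> \<in> space M \<Longrightarrow> gap d \<omega> \<le> 1"
  unfolding gap_def by (rule gap_facts)

lemma gap_integrable: "integrable M (gap d)"
  using gap_nonneg gap_le_1 by (intro integrable_const_bound[where B = 1]) auto

lemma beta_tilde_11_eq: "beta_tilde_11 M X d = expectation (gap d)"
  unfolding beta_tilde_11_def gap_def by (rule beta_tilde_eq[OF subalgebra_sigma_gen X_measurable])

lemma beta_tilde_11_nonneg: "0 \<le> beta_tilde_11 M X d"
  unfolding beta_tilde_11_eq using gap_nonneg by (intro Bochner_Integration.integral_nonneg) auto

lemma AE_gap_le_phi: "AE \<omega> in M. gap d \<omega> \<le> phi_tilde_11 M X d"
  unfolding phi_tilde_11_def gap_def by (rule AE_cdf_gap_le_phi_tilde[OF subalgebra_sigma_gen X_measurable])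

lemma phi_tilde_11_nonneg: "0 \<le> phi_tilde_11 M X d"
  unfolding phi_tilde_11_def phi_tilde_def by simp

section \<open>Covariances and variances of the hit counts\<close>

lemma prob_pair_le:
  assumes "0 < j" "j < k"
  shows "prob (B j \<inter> B k) \<le> prob (B j) * prob (B k)
    + 2 * expectation (\<lambda>\<omega>. indicator (hit0 j) \<omega> * gap (k - j) \<omega>)"
proof -
  \<comment> \<open>Writing k as \<open>(k - j) + j\<close> exhibits the pair as a shift by
    j.\<close>
  have "B j \<inter> B k = {\<omega> \<in> space M. X (int j) \<omega> \<in> I j \<and> X (int (k - j) + int j) \<omega> \<in> I k}"
    using assms by (auto simp: B_def of_nat_diff)
  then have "prob (B j \<inter> B k) = prob {\<omega> \<in> space M. X 0 \<omega> \<in> I j \<and> X (int (k - j)) \<omega> \<in> I k}"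
    using stationary_joint_prob[OF stationary interval_borel interval_borel, of j k "int j" "int (k - j)"] assms
    by simp
  also have "\<dots> = prob (hit0 j \<inter> {\<omega> \<in> space M. X (int (k - j)) \<omega> \<in> I k})"
    by (intro arg_cong[where f = prob]) (auto simp: hit0_def)
  also have "\<dots> \<le> prob (hit0 j) * prob {\<omega> \<in> space M. X (int (k - j)) \<omega> \<in> I k}
      + 2 * expectation (\<lambda>\<omega>. indicator (hit0 j) \<omega> * gap (k - j) \<omega>)"
    unfolding gap_def
    using assms by (intro prob_joint_le[OF subalgebra_sigma_gen X_measurable] hit0_sigma_gen interval) auto
  finally show ?thesis
    using assms prob_X[OF interval_borel[of k]] by (simp add: prob_B prob_hit0)
qed

definition hit_count :: "nat set \<Rightarrow> 'a \<Rightarrow> real" where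
  "hit_count S \<omega> = (\<Sum>j\<in>S. indicator (hit0 j) \<omega>)"

definition total_gap :: "nat \<Rightarrow> 'a \<Rightarrow> real" where
  "total_gap n \<omega> = (\<Sum>d=1..<n. gap d \<omega>)"

lemma total_gap_measurable [measurable]: "total_gap n \<in> borel_measurable M"
  unfolding total_gap_def by measurable

lemma total_gap_nonneg: "\<omega> \<in> space M \<Longrightarrow> 0 \<le> total_gap n \<omega>"
  unfolding total_gap_def using gap_nonneg by (intro sum_nonneg)

lemma total_gap_integrable: "integrable M (total_gap n)"
  unfolding total_gap_def using gap_integrable by auto

lemma expectation_total_gap: "expectation (total_gap n) = (\<Sum>d=1..<n. beta_tilde_11 M X d)"
  unfolding total_gap_def beta_tilde_11_eq using gap_integrable by simp

lemma hit_count_nonneg: "0 \<le> hit_count S \<omega>"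
  unfolding hit_count_def by (intro sum_nonneg) simp

lemma hit_count_measurable: "S \<subseteq> {1..n} \<Longrightarrow> hit_count S \<in> borel_measurable M"
  unfolding hit_count_def using hit0_events
  by (intro borel_measurable_sum borel_measurable_indicator) auto

lemma hit_count_times_gap:
  assumes S: "S \<subseteq> {1..n}"
  shows "integrable M (\<lambda>\<omega>. hit_count S \<omega> * total_gap n \<omega>)"
    and "expectation (\<lambda>\<omega>. hit_count S \<omega> * total_gap n \<omega>)
      = (\<Sum>j\<in>S. \<Sum>d=1..<n. expectation (\<lambda>\<omega>. indicator (hit0 j) \<omega> * gap d \<omega>))"
proof -
  let ?f = "\<lambda>j d \<omega>. indicator (hit0 j) \<omega> * gap d \<omega>"
  have int: "integrable M (?f j d)" if "j \<in> S" for j d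
    using integrable_real_mult_indicator[OF hit0_events[of j] gap_integrable[of d]] that S
    by (auto simp: mult.commute)
  have eq: "(\<lambda>\<omega>. hit_count S \<omega> * total_gap n \<omega>) = (\<lambda>\<omega>. \<Sum>j\<in>S. \<Sum>d=1..<n. ?f j d \<omega>)"
    by (simp only: hit_count_def total_gap_def sum_product)
  show "integrable M (\<lambda>\<omega>. hit_count S \<omega> * total_gap n \<omega>)"
    unfolding eq by (intro Bochner_Integration.integrable_sum int)
  have "expectation (\<lambda>\<omega>. \<Sum>j\<in>S. \<Sum>d=1..<n. ?f j d \<omega>) = (\<Sum>j\<in>S. expectation (\<lambda>\<omega>. \<Sum>d=1..<n. ?f j d \<omega>))"
    by (intro Bochner_Integration.integral_sum Bochner_Integration.integrable_sum int)
  also have "\<dots> = (\<Sum>j\<in>S. \<Sum>d=1..<n. expectation (?f j d))"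
    by (intro sum.cong refl Bochner_Integration.integral_sum int)
  finally show "expectation (\<lambda>\<omega>. hit_count S \<omega> * total_gap n \<omega>)
      = (\<Sum>j\<in>S. \<Sum>d=1..<n. expectation (?f j d))"
    unfolding eq .
qed

text \<open>The 4 combines the 2 of \<open>prob_pair_le\<close> with the 2 for the orders of a
  pair.\<close>

lemma expectation_square_hits_le:
  assumes S: "S \<subseteq> {1..n}"
  shows "expectation (\<lambda>\<omega>. ((\<Sum>k\<in>S. indicator (B k) \<omega>) - (\<Sum>k\<in>S. prob (B k)))\<^sup>2)
    \<le> (\<Sum>k\<in>S. prob (B k)) + 4 * expectation (\<lambda>\<omega>. hit_count S \<omega> * total_gap n \<omega>)"
proof -
  let ?c = "\<lambda>j d. 2 * expectation (\<lambda>\<omega>. indicator (hit0 j) \<omega> * gap d \<omega>)"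
  have "expectation (\<lambda>\<omega>. ((\<Sum>k\<in>S. indicator (B k) \<omega>) - (\<Sum>k\<in>S. prob (B k)))\<^sup>2)
      \<le> (\<Sum>k\<in>S. prob (B k)) + 2 * (\<Sum>j\<in>S. \<Sum>d=1..<n. ?c j d)"
  proof (rule expectation_square_count_le[OF S])
    show "B k \<in> events" if "k \<in> S" for k using that S by (intro B_events) auto
    show "0 \<le> ?c j d" for j d
      using gap_nonneg by (auto intro!: Bochner_Integration.integral_nonneg)
    show "prob (B j \<inter> B k) \<le> prob (B j) * prob (B k) + ?c j (k - j)"
      if "j \<in> S" "j < k" for j k
      using that S by (intro prob_pair_le) auto
  qed
  then show ?thesis
    using hit_count_times_gap(2)[OF S] by (simp add: sum_distrib_left[symmetric])
qed

lemma expectation_square_partial_count_le: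
  assumes "expectation (\<lambda>\<omega>. hit_count {1..n} \<omega> * total_gap n \<omega>) \<le> E n * H"
  shows "expectation (\<lambda>\<omega>. (partial_count B n \<omega> - E n)\<^sup>2) \<le> E n * (1 + 4 * H)"
  using expectation_square_hits_le[of "{1..n}" n, folded E_eq partial_count_def] assms
  by (simp add: algebra_simps)

lemma expectation_hit_count: "expectation (hit_count {1..n}) = E n"
proof -
  have "expectation (hit_count {1..n}) = (\<Sum>k=1..n. expectation (indicator (hit0 k)))"
    unfolding hit_count_def
    using hit0_events by (intro Bochner_Integration.integral_sum) (auto intro!: integrable_const_bound[where B = 1])
  also have "\<dots> = E n"
    unfolding E_def using hit0_events prob_hit0 by (intro sum.cong) auto
  finally show ?thesis .
qed

lemma hit_count_integrable:
  assumes "S \<subseteq> {1..n}" shows "integrable M (hit_count S)"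
  unfolding hit_count_def using hit0_events assms
  by (intro Bochner_Integration.integrable_sum integrable_const_bound[where B = 1]) auto

section \<open>Uniform coefficients: claims (iv) and (v)\<close>

lemma expectation_square_phi:
  "expectation (\<lambda>\<omega>. (partial_count B n \<omega> - E n)\<^sup>2) \<le> E n * (1 + 4 * (\<Sum>d=1..<n. phi_tilde_11 M X d))"
proof (rule expectation_square_partial_count_le)
  let ?s = "\<Sum>d=1..<n. phi_tilde_11 M X d"
  have "AE \<omega> in M. \<forall>d. gap d \<omega> \<le> phi_tilde_11 M X d"
    unfolding AE_all_countable using AE_gap_le_phi by blast
  then have "AE \<omega> in M. hit_count {1..n} \<omega> * total_gap n \<omega> \<le> hit_count {1..n} \<omega> * ?s"
    by eventually_elim (auto simp: total_gap_def intro!: mult_left_mono sum_mono hit_count_nonneg)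
  then have "expectation (\<lambda>\<omega>. hit_count {1..n} \<omega> * total_gap n \<omega>)
      \<le> expectation (\<lambda>\<omega>. hit_count {1..n} \<omega> * ?s)"
    by (intro integral_mono_AE hit_count_times_gap integrable_mult_left hit_count_integrable) auto
  then show "expectation (\<lambda>\<omega>. hit_count {1..n} \<omega> * total_gap n \<omega>) \<le> E n * ?s"
    by (simp only: expectation_hit_count integral_mult_left_zero)
qed

lemma L1_borel_cantelli_phi:
  assumes "(\<lambda>n. 1 / E n * (\<Sum>k=1..<n. phi_tilde_11 M X k)) \<longlonglongrightarrow> 0"
  shows "L1_borel_cantelli_seq M B"
proof (rule L1_borel_cantelli_of_variance[OF B_events E_eq divergent_B expectation_square_phi])
  have "(\<lambda>n. inverse (E n) + 4 * (1 / E n * (\<Sum>k=1..<n. phi_tilde_11 M X k))) \<longlonglongrightarrow> 0 + 4 * 0"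
    by (intro tendsto_intros assms tendsto_inverse_0_at_top E_tendsto)
  then show "(\<lambda>n. (1 + 4 * (\<Sum>d=1..<n. phi_tilde_11 M X d)) / E n) \<longlonglongrightarrow> 0"
    by (simp add: add_divide_distrib inverse_eq_divide)
qed

lemma summable_weights: "summable (\<lambda>n. measure \<mu> (I (Suc n)) / (E (Suc n))\<^sup>2)"
proof -
  \<comment> \<open>Unit mass at 1: its partial sums equal 1 from the second weight on, so the
    weights themselves become summable. The first weight meets an empty sum, hence the shift by one
    index.\<close>
  let ?\<phi> = "\<lambda>d::nat. if d = 1 then 1 else 0 :: real"
  have "summable (\<lambda>n. (E (Suc n) - E n) / (E (Suc n))\<^sup>2 * (\<Sum>d=1..<Suc n. ?\<phi> d))"
  proof (rule summable_weighted_partial_sums)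
    show "summable (\<lambda>n. 1 / E (Suc n) * ?\<phi> (Suc n))"
      by (rule summable_finite[of "{0}"]) auto
  qed (use E_pos in \<open>auto simp: E_Suc\<close>)
  then have "summable (\<lambda>n. (E (Suc (Suc n)) - E (Suc n)) / (E (Suc (Suc n)))\<^sup>2 * (\<Sum>d=1..<Suc (Suc n). ?\<phi> d))"
    by (subst summable_Suc_iff)
  moreover have "(\<Sum>d=1..<Suc (Suc n). ?\<phi> d) = 1" for n
    by (subst sum.delta) auto
  ultimately have "summable (\<lambda>n. measure \<mu> (I (Suc (Suc n))) / (E (Suc (Suc n)))\<^sup>2)"
    by (simp add: E_Suc)
  then show ?thesis by (subst (asm) summable_Suc_iff[of "\<lambda>n. measure \<mu> (I (Suc n)) / (E (Suc n))\<^sup>2"])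
qed

text \<open>The 1 in the variance bound contributes the bare weights, whose series always
  converges.\<close>

lemma strongly_borel_cantelli_of_summable:
  assumes var: "\<And>n. n > 0 \<Longrightarrow> expectation (\<lambda>\<omega>. (partial_count B n \<omega> - E n)\<^sup>2) \<le> E n * (1 + c * H n)"
    and sum: "summable (\<lambda>n. measure \<mu> (I (Suc n)) / (E (Suc n))\<^sup>2 * H (Suc n))"
  shows "strongly_borel_cantelli_seq M B"
proof (rule strongly_borel_cantelli_of_variance[OF B_events E_eq divergent_B _ var])
  show "prob (B 1) > 0" using first_pos by (simp add: prob_B)
  have "summable (\<lambda>n. measure \<mu> (I (Suc n)) / (E (Suc n))\<^sup>2
      + c * (measure \<mu> (I (Suc n)) / (E (Suc n))\<^sup>2 * H (Suc n)))"
    by (intro summable_add summable_mult summable_weights sum)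
  moreover have "a + c * (a * h) = a * (1 + c * h)" for a h :: real
    by (simp add: algebra_simps)
  ultimately show "summable (\<lambda>n. prob (B (Suc n)) / (E (Suc n))\<^sup>2 * (1 + c * H (Suc n)))"
    by (simp only: prob_B[OF zero_less_Suc])
qed

lemma strongly_borel_cantelli_phi:
  assumes "summable (\<lambda>n. 1 / E (Suc n) * phi_tilde_11 M X (Suc n))"
  shows "strongly_borel_cantelli_seq M B"
proof (rule strongly_borel_cantelli_of_summable[OF expectation_square_phi])
  show "summable (\<lambda>n. measure \<mu> (I (Suc n)) / (E (Suc n))\<^sup>2 * (\<Sum>d=1..<Suc n. phi_tilde_11 M X d))"
    using summable_weighted_partial_sums[of E "phi_tilde_11 M X", OF E_pos _ phi_tilde_11_nonneg assms]
    by (simp add: E_Suc)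
qed

section \<open>Integrated coefficients: claims (ii) and (iii)\<close>

lemma hit_count_eq: "\<omega> \<in> space M \<Longrightarrow> hit_count S \<omega> = (\<Sum>k\<in>S. indicator (I k) (X 0 \<omega>))"
  unfolding hit_count_def hit0_def by (intro sum.cong) (auto simp: indicator_def)

text \<open>The pointwise power inequality is linear in the gaps on its right-hand side, so
  expectations turn them into the beta coefficients with weights
  \<open>k powr (p - 1)\<close>.\<close>

lemma expectation_total_gap_powr:
  assumes p: "p \<ge> 1"
  shows "(\<integral>\<^sup>+\<omega>. ennreal (total_gap n \<omega> powr p) \<partial>M)
    \<le> ennreal (p * (\<Sum>k=1..<n. real k powr (p - 1) * beta_tilde_11 M X k))"
proof -
  have int: "integrable M (\<lambda>\<omega>. p * (\<Sum>k=1..<n. real k powr (p - 1) * gap k \<omega>))"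
    using gap_integrable by auto
  have "(\<integral>\<^sup>+\<omega>. ennreal (total_gap n \<omega> powr p) \<partial>M)
      \<le> (\<integral>\<^sup>+\<omega>. ennreal (p * (\<Sum>k=1..<n. real k powr (p - 1) * gap k \<omega>)) \<partial>M)"
    unfolding total_gap_def
    using gap_nonneg gap_le_1 by (intro nn_integral_mono ennreal_leI power_sum_le p) auto
  also have "\<dots> = ennreal (expectation (\<lambda>\<omega>. p * (\<Sum>k=1..<n. real k powr (p - 1) * gap k \<omega>)))"
    using gap_nonneg p by (intro nn_integral_eq_integral int AE_I2 mult_nonneg_nonneg sum_nonneg) auto
  also have "expectation (\<lambda>\<omega>. p * (\<Sum>k=1..<n. real k powr (p - 1) * gap k \<omega>))
      = p * (\<Sum>k=1..<n. real k powr (p - 1) * beta_tilde_11 M X k)"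
    unfolding beta_tilde_11_eq using gap_integrable by (simp add: Bochner_Integration.integral_sum)
  finally show ?thesis .
qed

text \<open>The finite supremum bounds the q-norm of every hit count by one multiple of
  \<open>E n\<close>, so a single \<open>c\<close> works for all n.\<close>

lemma expectation_square_beta:
  assumes p: "p \<ge> 1" and pq: "1 / ennreal p + 1 / q = 1"
    and fin: "(SUP n\<in>{0<..}. Lq_norm M q (\<lambda>\<omega>. \<Sum>k=1..n. indicator (I k) (X 0 \<omega>)) / ennreal (E n)) < \<infinity>"
  obtains c where "\<And>n. n > 0 \<Longrightarrow> expectation (\<lambda>\<omega>. (partial_count B n \<omega> - E n)\<^sup>2)
      \<le> E n * (1 + c * (\<Sum>k=1..<n. real k powr (p - 1) * beta_tilde_11 M X k) powr (1 / p))"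
proof -
  let ?N = "\<lambda>n. Lq_norm M q (\<lambda>\<omega>. \<Sum>k=1..n. indicator (I k) (X 0 \<omega>))"
  let ?s = "\<lambda>n. \<Sum>k=1..<n. real k powr (p - 1) * beta_tilde_11 M X k"
  have s0: "0 \<le> ?s n" for n by (intro sum_nonneg mult_nonneg_nonneg beta_tilde_11_nonneg) simp
  define s where "s = (SUP n\<in>{0<..}. ?N n / ennreal (E n))"
  obtain C0 where C0: "s = ennreal C0" "0 \<le> C0"
    using fin unfolding s_def[symmetric] by (cases s) auto
  \<comment> \<open>Adding 1 makes the constant positive, as \<open>nn_integral_Holder\<close>
    requires of its bound \<open>a\<close>.\<close>
  define C where "C = C0 + 1"
  have C: "C > 0" using C0 by (simp add: C_def)
  have N: "?N n \<le> ennreal (C * E n)" if n: "n > 0" for n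
  proof -
    have "?N n / ennreal (E n) \<le> ennreal C0"
      unfolding C0(1)[symmetric] s_def by (rule SUP_upper) (use n in simp)
    then have "?N n / ennreal (E n) * ennreal (E n) \<le> ennreal C0 * ennreal (E n)"
      by (rule mult_right_mono) simp
    moreover have "?N n / ennreal (E n) * ennreal (E n) = ?N n"
      using E_pos[OF n] by (simp add: ennreal_divide_times ennreal_mult_divide_eq)
    ultimately have "?N n \<le> ennreal (C0 * E n)"
      using C0 by (simp add: ennreal_mult')
    also have "\<dots> \<le> ennreal (C * E n)"
      using E_pos[OF n] by (intro ennreal_leI) (simp add: C_def)
    finally show ?thesis .
  qed
  have bound: "expectation (\<lambda>\<omega>. hit_count {1..n} \<omega> * total_gap n \<omega>)
      \<le> E n * (C * p powr (1 / p) * ?s n powr (1 / p))" if n: "n > 0" for n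
    using p pq
  proof (cases rule: conjugate_exponent_cases)
    \<comment> \<open>For p = 1 the hit count is almost surely bounded, and the weights
      \<open>k powr (p - 1)\<close> are all 1.\<close>
    case 1
    have "AE \<omega> in M. ennreal \<bar>\<Sum>k=1..n. indicator (I k) (X 0 \<omega>)\<bar> \<le> ?N n"
      unfolding 1 Lq_norm_def by (simp add: esssup_AE)
    then have "AE \<omega> in M. ennreal \<bar>\<Sum>k=1..n. indicator (I k) (X 0 \<omega>)\<bar> \<le> ennreal (C * E n)"
      by eventually_elim (use N[OF n] in \<open>auto intro: order_trans\<close>)
    with AE_space have "AE \<omega> in M. hit_count {1..n} \<omega> * total_gap n \<omega> \<le> C * E n * total_gap n \<omega>"
    proof eventually_elim
      case (elim \<omega>)
      have "0 \<le> C * E n" using C E_pos[OF n] by simp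
      then have "hit_count {1..n} \<omega> \<le> C * E n"
        using elim by (simp add: hit_count_eq ennreal_le_iff)
      then show ?case using total_gap_nonneg elim by (intro mult_right_mono) auto
    qed
    then have "expectation (\<lambda>\<omega>. hit_count {1..n} \<omega> * total_gap n \<omega>)
        \<le> expectation (\<lambda>\<omega>. C * E n * total_gap n \<omega>)"
      by (intro integral_mono_AE hit_count_times_gap integrable_mult_right total_gap_integrable) auto
    also have "\<dots> = C * E n * (\<Sum>d=1..<n. beta_tilde_11 M X d)"
      by (simp add: expectation_total_gap)
    also have "(\<Sum>d=1..<n. beta_tilde_11 M X d) = ?s n"
      using 1 by (intro sum.cong) auto
    finally show ?thesis using 1 s0[of n] by (simp add: mult_ac)
  next
    case (2 r)
    have a: "C * E n > 0" using C E_pos[OF n] by simp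
    let ?b = "(p * ?s n) powr (1 / p)"
    have b: "?b powr p = p * ?s n" using p s0[of n] by (simp add: powr_powr)
    \<comment> \<open>The absolute value is there because \<open>nn_integral_Holder\<close> wants
      nonnegative functions everywhere, while \<open>total_gap\<close> is known to be nonnegative
      only on \<open>space M\<close>.\<close>
    have "(\<integral>\<^sup>+\<omega>. ennreal (hit_count {1..n} \<omega> * \<bar>total_gap n \<omega>\<bar>) \<partial>M) \<le> ennreal (C * E n * ?b)"
    proof (rule nn_integral_Holder[where p = p and q = r])
      show "hit_count {1..n} \<in> borel_measurable M" by (rule hit_count_measurable[of _ n]) simp
      have "(\<integral>\<^sup>+\<omega>. ennreal (hit_count {1..n} \<omega> powr r) \<partial>M)
          = (\<integral>\<^sup>+\<omega>. ennreal (\<bar>\<Sum>k=1..n. indicator (I k) (X 0 \<omega>)\<bar> powr r) \<partial>M)"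
        by (intro nn_integral_cong) (simp add: hit_count_eq sum_nonneg)
      also have "\<dots> \<le> ennreal ((C * E n) powr r)"
        using N[OF n] 2 a by (intro Lq_norm_le_imp_nn_integral_le) auto
      finally show "(\<integral>\<^sup>+\<omega>. ennreal (hit_count {1..n} \<omega> powr r) \<partial>M) \<le> ennreal ((C * E n) powr r)" .
      have "(\<integral>\<^sup>+\<omega>. ennreal (\<bar>total_gap n \<omega>\<bar> powr p) \<partial>M) = (\<integral>\<^sup>+\<omega>. ennreal (total_gap n \<omega> powr p) \<partial>M)"
        using total_gap_nonneg by (intro nn_integral_cong) simp
      then show "(\<integral>\<^sup>+\<omega>. ennreal (\<bar>total_gap n \<omega>\<bar> powr p) \<partial>M) \<le> ennreal (?b powr p)"
        unfolding b using expectation_total_gap_powr[OF p, of n] by simp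
    qed (use 2 a hit_count_nonneg in auto)
    moreover have "(\<integral>\<^sup>+\<omega>. ennreal (hit_count {1..n} \<omega> * \<bar>total_gap n \<omega>\<bar>) \<partial>M)
        = ennreal (expectation (\<lambda>\<omega>. hit_count {1..n} \<omega> * total_gap n \<omega>))"
    proof -
      have "(\<integral>\<^sup>+\<omega>. ennreal (hit_count {1..n} \<omega> * \<bar>total_gap n \<omega>\<bar>) \<partial>M)
          = (\<integral>\<^sup>+\<omega>. ennreal (hit_count {1..n} \<omega> * total_gap n \<omega>) \<partial>M)"
        using total_gap_nonneg by (intro nn_integral_cong) simp
      also have "\<dots> = ennreal (expectation (\<lambda>\<omega>. hit_count {1..n} \<omega> * total_gap n \<omega>))"
        using hit_count_nonneg total_gap_nonneg
        by (intro nn_integral_eq_integral hit_count_times_gap AE_I2 mult_nonneg_nonneg) auto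
      finally show ?thesis .
    qed
    ultimately have "expectation (\<lambda>\<omega>. hit_count {1..n} \<omega> * total_gap n \<omega>) \<le> C * E n * ?b"
      using a by (simp add: ennreal_le_iff)
    then show ?thesis using p s0[of n] by (simp add: powr_mult mult_ac)
  qed
  show thesis
  proof (rule that)
    fix n :: nat assume "n > 0"
    then show "expectation (\<lambda>\<omega>. (partial_count B n \<omega> - E n)\<^sup>2)
        \<le> E n * (1 + (4 * (C * p powr (1 / p))) * ?s n powr (1 / p))"
      using expectation_square_partial_count_le[OF bound[of n]] by (simp add: mult_ac)
  qed
qed

lemma L1_borel_cantelli_beta:
  assumes p: "p \<ge> 1" and pq: "1 / ennreal p + 1 / q = 1"
    and lim: "(\<lambda>n. 1 / E n powr p * (\<Sum>k=1..<n. real k powr (p - 1) * beta_tilde_11 M X k)) \<longlonglongrightarrow> 0"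
    and fin: "(SUP n\<in>{0<..}. Lq_norm M q (\<lambda>\<omega>. \<Sum>k=1..n. indicator (I k) (X 0 \<omega>)) / ennreal (E n)) < \<infinity>"
  shows "L1_borel_cantelli_seq M B"
proof -
  let ?s = "\<lambda>n. \<Sum>k=1..<n. real k powr (p - 1) * beta_tilde_11 M X k"
  have s0: "0 \<le> ?s n" for n by (intro sum_nonneg mult_nonneg_nonneg beta_tilde_11_nonneg) simp
  obtain c where c: "\<And>n. n > 0 \<Longrightarrow> expectation (\<lambda>\<omega>. (partial_count B n \<omega> - E n)\<^sup>2)
      \<le> E n * (1 + c * ?s n powr (1 / p))"
    using expectation_square_beta[OF p pq fin] by blast
  \<comment> \<open>The hypothesis controls the p-th power of what the variance bound needs, so a
    p-th root is taken.\<close>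
  have "(\<lambda>n. (1 / E n powr p * ?s n) powr (1 / p)) \<longlonglongrightarrow> 0 powr (1 / p)"
    using p s0 by (intro tendsto_powr' lim tendsto_const) auto
  moreover have "\<forall>\<^sub>F n in sequentially. (1 / E n powr p * ?s n) powr (1 / p) = ?s n powr (1 / p) / E n"
    using eventually_gt_at_top[of 0]
  proof eventually_elim
    case (elim n)
    then show ?case
      using E_pos[of n] p s0[of n] by (simp add: powr_divide powr_powr)
  qed
  ultimately have "(\<lambda>n. ?s n powr (1 / p) / E n) \<longlonglongrightarrow> 0"
    using p by (simp add: tendsto_cong)
  then have "(\<lambda>n. inverse (E n) + c * (?s n powr (1 / p) / E n)) \<longlonglongrightarrow> 0 + c * 0"
    by (intro tendsto_intros tendsto_inverse_0_at_top E_tendsto)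
  then have "(\<lambda>n. (1 + c * ?s n powr (1 / p)) / E n) \<longlonglongrightarrow> 0"
    by (simp add: add_divide_distrib inverse_eq_divide)
  then show ?thesis
    by (intro L1_borel_cantelli_of_variance[OF B_events E_eq divergent_B c])
qed

lemma strongly_borel_cantelli_beta:
  assumes p: "p \<ge> 1" and pq: "1 / ennreal p + 1 / q = 1"
    and sum: "summable (\<lambda>n. measure \<mu> (I (Suc n)) / (E (Suc n))\<^sup>2 *
          (\<Sum>k=1..<Suc n. real k powr (p - 1) * beta_tilde_11 M X k) powr (1 / p))"
    and fin: "(SUP n\<in>{0<..}. Lq_norm M q (\<lambda>\<omega>. \<Sum>k=1..n. indicator (I k) (X 0 \<omega>)) / ennreal (E n)) < \<infinity>"
  shows "strongly_borel_cantelli_seq M B"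
proof -
  obtain c where c: "\<And>n. n > 0 \<Longrightarrow> expectation (\<lambda>\<omega>. (partial_count B n \<omega> - E n)\<^sup>2)
      \<le> E n * (1 + c * (\<Sum>k=1..<n. real k powr (p - 1) * beta_tilde_11 M X k) powr (1 / p))"
    using expectation_square_beta[OF p pq fin] by blast
  show ?thesis by (rule strongly_borel_cantelli_of_summable[OF c sum])
qed

section \<open>Thinned interval families: claim (i)\<close>

lemma low_overlap_block:
  assumes pos: "measure \<mu> (limsup I) > 0"
  shows "\<exists>S. finite S \<and> S \<subseteq> {m<..} \<and> measure \<mu> (limsup I) / 2 \<le> (\<Sum>k\<in>S. measure \<mu> (I k))
    \<and> (\<forall>x. card {k\<in>S. x \<in> I k} \<le> 2)"
proof -
  interpret \<mu>: prob_space \<mu> unfolding law[of 0, symmetric] by (rule prob_space_distr) simp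
  have sets_\<mu>: "sets \<mu> = sets borel" unfolding law[of 0, symmetric] by simp
  have Im: "I k \<in> sets \<mu>" if "k > 0" for k using interval_borel[OF that] sets_\<mu> by simp
  let ?U = "\<lambda>n. \<Union>k\<in>{m<..m + n}. I k"
  have "(\<lambda>n. measure \<mu> (?U n)) \<longlonglongrightarrow> measure \<mu> (\<Union>n. ?U n)"
  proof (rule \<mu>.finite_Lim_measure_incseq)
    show "range ?U \<subseteq> sets \<mu>" using Im by auto
    show "incseq ?U" by (force simp: incseq_def)
  qed
  moreover have "measure \<mu> (limsup I) \<le> measure \<mu> (\<Union>n. ?U n)"
  proof (rule \<mu>.finite_measure_mono)
    show "limsup I \<subseteq> (\<Union>n. ?U n)"
    proof
      fix x assume "x \<in> limsup I"
      then have "\<exists>\<^sub>\<infinity>n. x \<in> I n" by (simp add: mem_limsup_iff cofinite_eq_sequentially)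
      then obtain k where "m < k" "x \<in> I k" unfolding INFM_nat by blast
      then have "x \<in> ?U (k - m)" by auto
      then show "x \<in> (\<Union>n. ?U n)" by blast
    qed
  qed (use Im in auto)
  \<comment> \<open>The finite unions increase to a set containing the limsup. The half is just a
    fraction below 1, which a finite stage can exceed.\<close>
  ultimately have "\<forall>\<^sub>F n in sequentially. measure \<mu> (limsup I) / 2 < measure \<mu> (?U n)"
    using pos by (intro order_tendstoD(1)) auto
  then obtain n where n: "measure \<mu> (limsup I) / 2 < measure \<mu> (?U n)"
    using eventually_happens'[OF sequentially_bot] by blast
  obtain S where S: "S \<subseteq> {m<..m + n}" "(\<Union>k\<in>S. I k) = ?U n" "\<forall>x. card {k\<in>S. x \<in> I k} \<le> 2"
    using finite_intervals_cover_overlap_le_2[of "{m<..m + n}" I] interval by auto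
  have fin: "finite S" using S(1) finite_subset by blast
  have "measure \<mu> (\<Union>k\<in>S. I k) \<le> (\<Sum>k\<in>S. measure \<mu> (I k))"
    using S(1) Im by (intro \<mu>.finite_measure_subadditive_finite fin) auto
  with n S fin show ?thesis by (intro exI[of _ S]) auto
qed

text \<open>Each new block begins beyond all indices used so far, so the index sets are disjoint and
  both means and multiplicities add up.\<close>

lemma low_overlap_family:
  assumes pos: "measure \<mu> (limsup I) > 0"
  shows "\<exists>S. finite S \<and> S \<subseteq> {m<..} \<and> real N * (measure \<mu> (limsup I) / 2) \<le> (\<Sum>k\<in>S. measure \<mu> (I k))
    \<and> (\<forall>x. card {k\<in>S. x \<in> I k} \<le> 2 * N)"
proof (induction N)
  case 0
  show ?case by (intro exI[of _ "{}"]) auto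
next
  case (Suc N)
  then obtain S where S: "finite S" "S \<subseteq> {m<..}"
    "real N * (measure \<mu> (limsup I) / 2) \<le> (\<Sum>k\<in>S. measure \<mu> (I k))"
    "\<And>x. card {k\<in>S. x \<in> I k} \<le> 2 * N" by blast
  obtain n where n: "\<And>k. k \<in> S \<Longrightarrow> k \<le> n" using S(1) unfolding finite_nat_set_iff_bounded_le by blast
  obtain T where T: "finite T" "T \<subseteq> {max m n<..}"
    "measure \<mu> (limsup I) / 2 \<le> (\<Sum>k\<in>T. measure \<mu> (I k))" "\<And>x. card {k\<in>T. x \<in> I k} \<le> 2"
    using low_overlap_block[OF pos, of "max m n"] by blast
  have disj: "S \<inter> T = {}" using n T(2) by fastforce
  have "card {k\<in>S \<union> T. x \<in> I k} \<le> 2 * Suc N" for x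
  proof -
    have "{k\<in>S \<union> T. x \<in> I k} = {k\<in>S. x \<in> I k} \<union> {k\<in>T. x \<in> I k}" by auto
    then show ?thesis
      using card_Un_le[of "{k\<in>S. x \<in> I k}" "{k\<in>T. x \<in> I k}"] S(4)[of x] T(4)[of x] by simp
  qed
  moreover have "real (Suc N) * (measure \<mu> (limsup I) / 2) \<le> (\<Sum>k\<in>S \<union> T. measure \<mu> (I k))"
    using S T disj by (simp add: sum.union_disjoint algebra_simps add_divide_distrib)
  ultimately show ?case
    using S T by (intro exI[of _ "S \<union> T"]) auto
qed

text \<open>The pointwise bound 2 N on the hit count does double duty: it bounds the mean count by 2
  N, and multiplied by the summable beta coefficients it bounds the correlation term by 8 N
  \<open>?b\<close>. Together these give the variance bound 2 N (1 + 4 \<open>?b\<close>).\<close>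

lemma prob_hit_after:
  assumes pos: "measure \<mu> (limsup I) > 0" and sum: "summable (\<lambda>k. beta_tilde_11 M X (Suc k))"
  shows "prob (\<Union>k\<in>{m<..}. B k) = 1"
proof -
  let ?c = "measure \<mu> (limsup I) / 2"
  let ?b = "\<Sum>k. beta_tilde_11 M X (Suc k)"
  let ?U = "\<Union>k\<in>{m<..}. B k"
  have U [measurable]: "?U \<in> events" using B_events by (intro sets.countable_UN') auto
  have le: "prob (space M - ?U) * ?c\<^sup>2 \<le> 2 * (1 + 4 * ?b) / real N" if N: "N > 0" for N
  proof -
    obtain S where S: "finite S" "S \<subseteq> {m<..}" "real N * ?c \<le> (\<Sum>k\<in>S. measure \<mu> (I k))"
      "\<And>x. card {k\<in>S. x \<in> I k} \<le> 2 * N"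
      using low_overlap_family[OF pos, of m N] by blast
    obtain n where "\<And>k. k \<in> S \<Longrightarrow> k \<le> n" using S(1) unfolding finite_nat_set_iff_bounded_le by blast
    then have Sn: "S \<subseteq> {1..n}" using S(2) by fastforce
    have mult: "hit_count S \<omega> \<le> 2 * real N" if "\<omega> \<in> space M" for \<omega>
    proof -
      have "hit_count S \<omega> = real (card {k\<in>S. X 0 \<omega> \<in> I k})"
        using that S(1) by (simp add: hit_count_eq indicator_def sum.If_cases Int_def)
      also have "\<dots> \<le> real (2 * N)" using S(4) by (simp only: of_nat_le_iff)
      finally show ?thesis by simp
    qed
    let ?p = "\<Sum>k\<in>S. prob (B k)"
    have p_eq: "?p = (\<Sum>k\<in>S. measure \<mu> (I k))"
      using Sn by (intro sum.cong prob_B) auto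
    have "?p = expectation (hit_count S)"
      unfolding hit_count_def
    proof (subst Bochner_Integration.integral_sum)
      show "?p = (\<Sum>k\<in>S. expectation (indicator (hit0 k)))"
        using Sn hit0_events by (intro sum.cong) (auto simp: prob_B prob_hit0 subset_iff)
    qed (use Sn hit0_events in \<open>auto intro!: integrable_const_bound[where B = 1]\<close>)
    also have "\<dots> \<le> expectation (\<lambda>_. 2 * real N)"
      by (intro integral_mono hit_count_integrable[OF Sn] mult) auto
    finally have p_le: "?p \<le> 2 * real N" by (simp add: prob_space)
    have "expectation (\<lambda>\<omega>. hit_count S \<omega> * total_gap n \<omega>) \<le> expectation (\<lambda>\<omega>. 2 * real N * total_gap n \<omega>)"
      using mult total_gap_nonneg
      by (intro integral_mono hit_count_times_gap[OF Sn] integrable_mult_right total_gap_integrable mult_right_mono) auto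
    also have "\<dots> = 2 * real N * (\<Sum>d=1..<n. beta_tilde_11 M X d)"
      by (simp add: expectation_total_gap)
    also have "(\<Sum>d=1..<n. beta_tilde_11 M X d) = (\<Sum>d<n - 1. beta_tilde_11 M X (Suc d))"
      by (rule sum.reindex_bij_witness[of _ Suc "\<lambda>d. d - 1"]) auto
    also have "2 * real N * \<dots> \<le> 2 * real N * ?b"
      by (intro mult_left_mono sum_le_suminf sum) (auto simp: beta_tilde_11_nonneg)
    finally have "expectation (\<lambda>\<omega>. hit_count S \<omega> * total_gap n \<omega>) \<le> 2 * real N * ?b" .
    with expectation_square_hits_le[OF Sn] p_le
    have var: "expectation (\<lambda>\<omega>. ((\<Sum>k\<in>S. indicator (B k) \<omega>) - ?p)\<^sup>2) \<le> 2 * real N * (1 + 4 * ?b)"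
      by (simp add: algebra_simps)
    \<comment> \<open>Chebyshev's inequality by hand: off \<open>?U\<close> the count is 0, so it
      deviates from its mean by at least \<open>real N * ?c\<close>.\<close>
    have "prob (space M - ?U) * (real N * ?c)\<^sup>2 = expectation (\<lambda>\<omega>. indicator (space M - ?U) \<omega> * (real N * ?c)\<^sup>2)"
      by simp
    also have "\<dots> \<le> expectation (\<lambda>\<omega>. ((\<Sum>k\<in>S. indicator (B k) \<omega>) - ?p)\<^sup>2)"
    proof (rule integral_mono)
      show "integrable M (\<lambda>\<omega>. ((\<Sum>k\<in>S. indicator (B k) \<omega>) - ?p)\<^sup>2)"
        using Sn S(1) by (intro integrable_count_square B_events) auto
      show "integrable M (\<lambda>\<omega>. indicator (space M - ?U) \<omega> * (real N * ?c)\<^sup>2)"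
        by (intro integrable_mult_left integrable_const_bound[where B = 1]) auto
      fix \<omega> assume "\<omega> \<in> space M"
      show "indicator (space M - ?U) \<omega> * (real N * ?c)\<^sup>2 \<le> ((\<Sum>k\<in>S. indicator (B k) \<omega>) - ?p)\<^sup>2"
      proof (cases "\<omega> \<in> ?U")
        case False
        then have "(\<Sum>k\<in>S. indicator (B k) \<omega>) = (0 :: real)"
          using S(2) by (intro sum.neutral) (auto simp: indicator_def)
        moreover have "(real N * ?c)\<^sup>2 \<le> ?p\<^sup>2"
          using S(3) pos by (intro power_mono) (auto simp: p_eq)
        ultimately show ?thesis by (simp add: indicator_def)
      qed simp
    qed
    also note var
    also have "prob (space M - ?U) * (real N * ?c)\<^sup>2 = prob (space M - ?U) * ?c\<^sup>2 * (real N * real N)"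
      by (simp only: power2_eq_square mult_ac)
    finally have "prob (space M - ?U) * ?c\<^sup>2 * (real N * real N) \<le> 2 * (1 + 4 * ?b) * real N"
      by (simp only: mult_ac)
    then have "prob (space M - ?U) * ?c\<^sup>2 * real N \<le> 2 * (1 + 4 * ?b)"
      using N by (simp only: mult.assoc[symmetric] mult_le_cancel_right)
    then show ?thesis using N by (simp add: le_divide_eq)
  qed
  have "(\<lambda>N. 2 * (1 + 4 * ?b) / real N) \<longlonglongrightarrow> 0"
    by (rule lim_const_over_n)
  then have "prob (space M - ?U) * ?c\<^sup>2 \<le> 0"
    by (rule LIMSEQ_le_const) (use le in \<open>auto intro!: exI[of _ 1]\<close>)
  then have "prob (space M - ?U) \<le> 0" using pos by (simp add: mult_le_0_iff)
  then show ?thesis using prob_compl[OF U] prob_le_1[of ?U] by linarith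
qed

lemma borel_cantelli_beta:
  assumes "measure \<mu> (limsup I) > 0" "summable (\<lambda>k. beta_tilde_11 M X (Suc k))"
  shows "borel_cantelli_seq M B"
proof -
  \<comment> \<open>The strict bound keeps the unconstrained set \<open>B 0\<close> out of every
    tail.\<close>
  let ?U = "\<lambda>m. \<Union>k\<in>{m<..}. B k"
  have U [measurable]: "?U m \<in> events" for m using B_events by (intro sets.countable_UN') auto
  have eq: "limsup B = (\<Inter>m. ?U m)"
  proof (rule set_eqI)
    fix \<omega>
    have "\<omega> \<in> limsup B \<longleftrightarrow> (\<exists>\<^sub>\<infinity>n. \<omega> \<in> B n)" by (simp add: mem_limsup_iff cofinite_eq_sequentially)
    then show "\<omega> \<in> limsup B \<longleftrightarrow> \<omega> \<in> (\<Inter>m. ?U m)" unfolding INFM_nat by auto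
  qed
  have "AE \<omega> in M. \<forall>m. \<omega> \<in> ?U m"
    unfolding AE_all_countable
    using prob_hit_after[OF assms] by (auto simp: prob_eq_1[OF U])
  then have "AE \<omega> in M. \<omega> \<in> (\<Inter>m. ?U m)" by eventually_elim blast
  moreover have "(\<Inter>m. ?U m) \<in> events" by (intro sets.countable_INT) auto
  ultimately show ?thesis
    unfolding borel_cantelli_seq_def eq by (simp add: prob_eq_1)
qed

end

theorem theorem4p1:
  fixes M :: "'a measure" and X :: "int \<Rightarrow> 'a \<Rightarrow> real" and \<mu> :: "real measure"
    and I :: "nat \<Rightarrow> real set" and B :: "nat \<Rightarrow> 'a set" and E :: "nat \<Rightarrow> real"
  assumes "prob_space M"
    and "strictly_stationary M X"
    and "\<And>i. distr M borel (X i) = \<mu>"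
    and "\<And>k. k > 0 \<Longrightarrow> is_interval (I k)"
    and "measure \<mu> (I 1) > 0"
    and "(\<Sum>k. emeasure \<mu> (I (Suc k))) = \<infinity>"
    and B_def: "\<And>k. k > 0 \<Longrightarrow> B k = {\<omega> \<in> space M. X (int k) \<omega> \<in> I k}"
    and E_def: "\<And>n. E n = (\<Sum>k=1..n. measure \<mu> (I k))"
  shows
    \<comment> \<open>(i)\<close>
    "(measure \<mu> (limsup I) > 0 \<and> summable (\<lambda>k. beta_tilde_11 M X (Suc k))
        \<longrightarrow> borel_cantelli_seq M B) \<and>
    \<comment> \<open>(ii)\<close>
     (\<forall>p::real. \<forall>q::ennreal. p \<ge> 1 \<and> 1 / ennreal p + 1 / q = 1 \<and>
        (\<lambda>n. 1 / E n powr p * (\<Sum>k=1..<n. real k powr (p - 1) * beta_tilde_11 M X k))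
          \<longlonglongrightarrow> 0 \<and>
        (SUP n\<in>{0<..}. Lq_norm M q (\<lambda>\<omega>. \<Sum>k=1..n. indicator (I k) (X 0 \<omega>)) / ennreal (E n)) < \<infinity>
        \<longrightarrow> L1_borel_cantelli_seq M B) \<and>
    \<comment> \<open>(iii)\<close>
     (\<forall>p::real. \<forall>q::ennreal. p \<ge> 1 \<and> 1 / ennreal p + 1 / q = 1 \<and>
        summable (\<lambda>n. measure \<mu> (I (Suc n)) / (E (Suc n))\<^sup>2 *
          (\<Sum>k=1..<Suc n. real k powr (p - 1) * beta_tilde_11 M X k) powr (1 / p)) \<and>
        (SUP n\<in>{0<..}. Lq_norm M q (\<lambda>\<omega>. \<Sum>k=1..n. indicator (I k) (X 0 \<omega>)) / ennreal (E n)) < \<infinity>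
        \<longrightarrow> strongly_borel_cantelli_seq M B) \<and>
    \<comment> \<open>(iv)\<close>
     ((\<lambda>n. 1 / E n * (\<Sum>k=1..<n. phi_tilde_11 M X k)) \<longlonglongrightarrow> 0
        \<longrightarrow> L1_borel_cantelli_seq M B) \<and>
    \<comment> \<open>(v)\<close>
     (summable (\<lambda>n. 1 / E (Suc n) * phi_tilde_11 M X (Suc n))
        \<longrightarrow> strongly_borel_cantelli_seq M B)"
proof -
  have "stationary_interval_hits_axioms M X \<mu> I B E"
    by (rule stationary_interval_hits_axioms.intro) fact+
  then interpret stationary_interval_hits M X \<mu> I B E
    by (intro stationary_interval_hits.intro assms(1))
  show ?thesis
    by (intro conjI allI impI; (elim conjE)?)
      (rule borel_cantelli_beta L1_borel_cantelli_beta strongly_borel_cantelli_beta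
        L1_borel_cantelli_phi strongly_borel_cantelli_phi; assumption)+
qed

end
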